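(* Let $A$ be a discrete valuation ring with maximal ideal $\mathfrak m=tA$ and completion $\hat A$, let $z\in\hat A$ be an element satisfying the hypotheses of Akizuki's construction (stated in the context), and let $C_M$ be the resulting Akizuki local domain. For every $C_M$-linear map $$\Phi\colon \mathrm H^1_{MC_M}(C_M)\to\operatorname{Hom}_A^c(C_M,K/A)$$ there exist $\sigma,\rho\in\hat A$ such that $\Phi=\Phi_{\sigma,\rho}$, where $\Phi_{\sigma,\rho}$ is the $C_M$-linear map given by $\Phi_{\sigma,\rho}(\omega)(f)=\operatorname{res}_{\sigma,\rho}(f\omega)$ for $\omega\in \mathrm H^1_{MC_M}(C_M)$ and $f\in C_M$.
   Context: Akizuki's construction. $A$ is a discrete valuation ring with maximal ideal $\mathfrak m=tA$, $\hat A$ is its completion, and $K$, $\hat K$ are the quotient fields of $A$, $\hat A$. Assume there is an element $z=a_0+a_1t^{n_1}+a_2t^{n_2}+\cdots\in\hat A$ with all $a_i\in A\setminus\mathfrak m$, transcendental over $A$, where $n_0=0$ and $n_r\ge 2n_{r-1}+2$ for all $r\ge 1$. For $r\ge 0$ put $z_r=a_r+a_{r+1}t^{n_{r+1}-n_r}+a_{r+2}t^{n_{r+2}-n_r}+\cdots\in\hat A$ (so $z_0=z$). Let $C=A[t(z_0-a_0),\{(z_i-a_i)^2\}_{i=0}^\infty]\subset\hat A$, let $M$ be the maximal ideal of $C$ generated by $t$ and $t(z_0-a_0)$, and let $C_M$ be the localization of $C$ at $M$. By Akizuki, $C_M$ is a one-dimensional Noetherian local domain; its quotient field is $K(z)=(C_M)_t$.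 Generalized fractions. The local cohomology module $\mathrm H^1_{MC_M}(C_M)$ is identified with $(C_M)_t/C_M$ via the exact sequence $0\to C_M\to (C_M)_t\to \mathrm H^1_{MC_M}(C_M)\to 0$. For $f\in C_M$ and $n>0$, $\left[\begin{smallmatrix} f\\ t^n\end{smallmatrix}\right]_{C_M}$ denotes the image of $f/t^n$ in $\mathrm H^1_{MC_M}(C_M)$. For $f\in\hat A$ and $n>0$, $\left[\begin{smallmatrix} f\\ t^n\end{smallmatrix}\right]_{A}$ denotes the image of $f/t^n$ in $\hat K/\hat A$, and also the corresponding element of $K/A$ under the canonical isomorphism $K/A\to\hat K/\hat A$. Residue maps. Every element of $\mathrm H^1_{MC_M}(C_M)$ can be written as $\left[\begin{smallmatrix} X+Yt(z_0-a_0)\\ t^n\end{smallmatrix}\right]_{C_M}$ with $X,Y\in A$. For $\sigma,\rho\in\hat A$, $\operatorname{res}_{\sigma,\rho}\colon \mathrm H^1_{MC_M}(C_M)\to K/A$ is the (well-defined) $A$-linear map with $$\left[\begin{smallmatrix} X+Yt(z_0-a_0)\\ t^n\end{smallmatrix}\right]_{C_M}\mapsto\left[\begin{smallmatrix} X\sigma+Y\rho\\ t^n\end{smallmatrix}\right]_{A}\qquad(X,Y\in A).$$ Continuous homomorphisms. $\operatorname{Hom}_A^c(C_M,K/A)=\{\varphi\in\operatorname{Hom}_A(C_M,K/A)\mid \varphi(M^nC_M)=0\text{ for some }n\}$, a $C_M$-module via $(g\varphi)(f)=\varphi(gf)$. *)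

theory Defs
  imports
    "HOL-Computational_Algebra.Polynomial"
    "HOL-Computational_Algebra.Fraction_Field"
    "HOL-Library.Set_Algebras"
    "HOL-Library.FuncSet"
begin

text \<open>Rings are represented as subsets \<open>R\<close> of an ambient ring type. The \<open>R\<close>-submodule generated
  by \<open>S\<close> is the ideal generated by \<open>S\<close> when \<open>S \<subseteq> R\<close>.\<close>

definition ideal_span :: "'b::comm_ring_1 set \<Rightarrow> 'b set \<Rightarrow> 'b set" where
  "ideal_span R S = \<Inter>{I. S \<subseteq> I \<and> 0 \<in> I \<and> (\<forall>x\<in>I. \<forall>y\<in>I. x + y \<in> I) \<and> (\<forall>r\<in>R. \<forall>x\<in>I. r * x \<in> I)}"

primrec ideal_pow :: "'b::comm_ring_1 set \<Rightarrow> 'b set \<Rightarrow> nat \<Rightarrow> 'b set" where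
  "ideal_pow R I 0 = R"
| "ideal_pow R I (Suc n) = ideal_span R {x * y | x y. x \<in> I \<and> y \<in> ideal_pow R I n}"

definition subring_span :: "'b::comm_ring_1 set \<Rightarrow> 'b set" where
  "subring_span S = \<Inter>{R. S \<subseteq> R \<and> 1 \<in> R \<and> (\<forall>x\<in>R. \<forall>y\<in>R. x - y \<in> R \<and> x * y \<in> R)}"

definition localize :: "'b::field set \<Rightarrow> 'b set \<Rightarrow> 'b set" where
  "localize R S = {x / s | x s. x \<in> R \<and> s \<in> S}"

text \<open>For subgroups \<open>P \<subseteq> N\<close>, the quotient \<open>N/P\<close> is the set of cosets \<open>x + P\<close>. Addition of cosets is
  addition of sets and the zero element is \<open>P\<close>, but \<open>r *o (x +o P)\<close> is only the subset
  \<open>rx + rP\<close> of the coset \<open>rx + P\<close>.\<close>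

definition quot :: "'b::comm_ring_1 set \<Rightarrow> 'b set \<Rightarrow> 'b set set" where
  "quot N P = (\<lambda>x. x +o P) ` N"

definition quot_scale :: "'b::comm_ring_1 set \<Rightarrow> 'b \<Rightarrow> 'b set \<Rightarrow> 'b set" where
  "quot_scale P r c = (r *o c) + P"

text \<open>A discrete valuation ring is a local principal ideal domain that is not a field.\<close>

class dvr = idom +
  assumes principal: "0 \<in> I \<Longrightarrow> (\<And>x y. x \<in> I \<Longrightarrow> y \<in> I \<Longrightarrow> x + y \<in> I) \<Longrightarrow>
      (\<And>r x. x \<in> I \<Longrightarrow> r * x \<in> I) \<Longrightarrow> \<exists>g. I = {x. g dvd x}"
    and nonunits_add: "\<not> x dvd 1 \<Longrightarrow> \<not> y dvd 1 \<Longrightarrow> \<not> (x + y) dvd 1"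
    and not_field: "\<exists>x. x \<noteq> 0 \<and> \<not> x dvd 1"

definition max_ideal :: "'a::dvr set" where
  "max_ideal = {x. \<not> x dvd 1}"

abbreviation max_ideal_pow :: "nat \<Rightarrow> 'a::dvr set" where
  "max_ideal_pow \<equiv> ideal_pow UNIV max_ideal"

definition adic_cauchy :: "(nat \<Rightarrow> 'a::dvr) \<Rightarrow> bool" where
  "adic_cauchy X \<longleftrightarrow> (\<forall>N. \<exists>k. \<forall>i\<ge>k. \<forall>j\<ge>k. X i - X j \<in> max_ideal_pow N)"

definition adic_null :: "(nat \<Rightarrow> 'a::dvr) \<Rightarrow> bool" where
  "adic_null X \<longleftrightarrow> (\<forall>N. \<exists>k. \<forall>i\<ge>k. X i \<in> max_ideal_pow N)"

definition adic_rel :: "(nat \<Rightarrow> 'a::dvr) \<Rightarrow> (nat \<Rightarrow> 'a) \<Rightarrow> bool" where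
  "adic_rel X Y \<longleftrightarrow> adic_cauchy X \<and> adic_cauchy Y \<and> adic_null (\<lambda>i. X i - Y i)"

lemma max_ideal_generator:
  obtains t :: "'a::dvr" where "max_ideal = {x. t dvd x}" "prime_elem t"
proof -
  have "\<exists>t::'a. max_ideal = {x. t dvd x}"
  proof (rule principal)
    show "0 \<in> (max_ideal :: 'a set)" by (simp add: max_ideal_def)
  next
    fix x y :: 'a
    assume "x \<in> max_ideal" "y \<in> max_ideal"
    then show "x + y \<in> max_ideal" by (simp add: max_ideal_def nonunits_add)
  next
    fix r x :: 'a
    assume "x \<in> max_ideal"
    then show "r * x \<in> max_ideal"
      using dvd_mult_right[of r x 1] unfolding max_ideal_def by blast
  qed
  then obtain t :: 'a where t: "max_ideal = {x. t dvd x}" by blast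
  have t_iff: "t dvd x \<longleftrightarrow> \<not> x dvd 1" for x
    using t unfolding max_ideal_def by blast
  obtain x :: 'a where "x \<noteq> 0" "\<not> x dvd 1" using not_field by blast
  then have "t \<noteq> 0" using t_iff[of x] by auto
  moreover have "\<not> t dvd 1" using t_iff[of t] by simp
  moreover have "t dvd x \<or> t dvd y" if "t dvd x * y" for x y :: 'a
  proof -
    have "\<not> (x * y) dvd 1" using that t_iff by blast
    then have "\<not> x dvd 1 \<or> \<not> y dvd 1" using mult_dvd_mono[of x 1 y 1] by auto
    then show ?thesis using t_iff by blast
  qed
  ultimately have "prime_elem t" unfolding prime_elem_def by blast
  with t that show thesis by blast
qed

lemma max_ideal_pow_eq:
  fixes t :: "'a::dvr"
  assumes "max_ideal = {x. t dvd x}"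
  shows "max_ideal_pow N = {x. t ^ N dvd x}"
proof (induction N)
  case (Suc N)
  have "t ^ Suc N * r \<in> max_ideal_pow (Suc N)" for r
  proof -
    have "t * (t ^ N * r) \<in> {x * y |x y. x \<in> max_ideal \<and> y \<in> max_ideal_pow N}"
      using assms Suc by (metis (mono_tags, lifting) dvd_refl dvd_triv_left mem_Collect_eq)
    then show ?thesis by (auto simp: ideal_span_def mult.assoc)
  qed
  moreover have "max_ideal_pow (Suc N) \<subseteq> {x. t ^ Suc N dvd x}"
    unfolding ideal_pow.simps ideal_span_def Suc
    by (rule Inter_lower) (auto simp: assms intro: mult_dvd_mono)
  ultimately show ?case by (auto elim!: dvdE)
qed auto

lemma max_ideal_pow_closed:
  fixes x y :: "'a::dvr"
  shows "0 \<in> (max_ideal_pow N :: 'a set)"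
    and "x \<in> max_ideal_pow N \<Longrightarrow> y \<in> max_ideal_pow N \<Longrightarrow> x + y \<in> max_ideal_pow N"
    and "x \<in> max_ideal_pow N \<Longrightarrow> y \<in> max_ideal_pow N \<Longrightarrow> x - y \<in> max_ideal_pow N"
    and "x \<in> max_ideal_pow N \<Longrightarrow> r * x \<in> max_ideal_pow N"
    and "x \<in> max_ideal_pow N \<Longrightarrow> x * r \<in> max_ideal_pow N"
proof -
  obtain t :: 'a where "max_ideal = {x. t dvd x}" by (rule max_ideal_generator)
  note eq = max_ideal_pow_eq[OF this]
  show "0 \<in> (max_ideal_pow N :: 'a set)"
    and "x \<in> max_ideal_pow N \<Longrightarrow> y \<in> max_ideal_pow N \<Longrightarrow> x + y \<in> max_ideal_pow N"
    and "x \<in> max_ideal_pow N \<Longrightarrow> y \<in> max_ideal_pow N \<Longrightarrow> x - y \<in> max_ideal_pow N"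
    and "x \<in> max_ideal_pow N \<Longrightarrow> r * x \<in> max_ideal_pow N"
    and "x \<in> max_ideal_pow N \<Longrightarrow> x * r \<in> max_ideal_pow N"
    by (simp_all add: eq)
qed

lemma adic_cauchy_const: "adic_cauchy (\<lambda>_. x)"
  by (simp add: adic_cauchy_def max_ideal_pow_closed)

lemma adic_cauchy_add:
  assumes "adic_cauchy X" "adic_cauchy Y"
  shows "adic_cauchy (\<lambda>i. X i + Y i)"
  unfolding adic_cauchy_def
proof
  fix N
  obtain k l where "\<forall>i\<ge>k. \<forall>j\<ge>k. X i - X j \<in> max_ideal_pow N"
    "\<forall>i\<ge>l. \<forall>j\<ge>l. Y i - Y j \<in> max_ideal_pow N"
    using assms unfolding adic_cauchy_def by blast
  then have "(X i - X j) + (Y i - Y j) \<in> max_ideal_pow N" if "i \<ge> max k l" "j \<ge> max k l" for i j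
    using that by (intro max_ideal_pow_closed(2)) auto
  then show "\<exists>k. \<forall>i\<ge>k. \<forall>j\<ge>k. X i + Y i - (X j + Y j) \<in> max_ideal_pow N"
    by (intro exI[of _ "max k l"]) (simp add: algebra_simps)
qed

lemma adic_cauchy_mult:
  assumes "adic_cauchy X" "adic_cauchy Y"
  shows "adic_cauchy (\<lambda>i. X i * Y i)"
  unfolding adic_cauchy_def
proof
  fix N
  obtain k l where "\<forall>i\<ge>k. \<forall>j\<ge>k. X i - X j \<in> max_ideal_pow N"
    "\<forall>i\<ge>l. \<forall>j\<ge>l. Y i - Y j \<in> max_ideal_pow N"
    using assms unfolding adic_cauchy_def by blast
  then have "(X i - X j) * Y i + X j * (Y i - Y j) \<in> max_ideal_pow N"
    if "i \<ge> max k l" "j \<ge> max k l" for i j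
    using that by (intro max_ideal_pow_closed(2,4,5)) auto
  then show "\<exists>k. \<forall>i\<ge>k. \<forall>j\<ge>k. X i * Y i - X j * Y j \<in> max_ideal_pow N"
    by (intro exI[of _ "max k l"]) (simp add: algebra_simps)
qed

lemma adic_cauchy_uminus: "adic_cauchy X \<Longrightarrow> adic_cauchy (\<lambda>i. - X i)"
  using adic_cauchy_mult[OF adic_cauchy_const[of "-1"]] by simp

lemma adic_null_const: "adic_null (\<lambda>_. 0)"
  by (simp add: adic_null_def max_ideal_pow_closed)

lemma adic_null_add:
  assumes "adic_null X" "adic_null Y"
  shows "adic_null (\<lambda>i. X i + Y i)"
  unfolding adic_null_def
proof
  fix N
  obtain k l where "\<forall>i\<ge>k. X i \<in> max_ideal_pow N" "\<forall>i\<ge>l. Y i \<in> max_ideal_pow N"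
    using assms unfolding adic_null_def by blast
  then have "\<forall>i\<ge>max k l. X i + Y i \<in> max_ideal_pow N"
    by (simp add: max_ideal_pow_closed(2))
  then show "\<exists>k. \<forall>i\<ge>k. X i + Y i \<in> max_ideal_pow N" ..
qed

lemma adic_null_mult:
  assumes "adic_null X"
  shows "adic_null (\<lambda>i. Y i * X i)"
  unfolding adic_null_def
proof
  fix N
  obtain k where "\<forall>i\<ge>k. X i \<in> max_ideal_pow N"
    using assms unfolding adic_null_def by blast
  then have "\<forall>i\<ge>k. Y i * X i \<in> max_ideal_pow N"
    by (simp add: max_ideal_pow_closed(4))
  then show "\<exists>k. \<forall>i\<ge>k. Y i * X i \<in> max_ideal_pow N" ..
qed

lemma adic_null_uminus: "adic_null X \<Longrightarrow> adic_null (\<lambda>i. - X i)"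
  using adic_null_mult[of X "\<lambda>_. -1"] by simp

lemma adic_cauchy_not_null:
  assumes "adic_cauchy X" "\<not> adic_null X"
  shows "\<exists>N k. \<forall>i\<ge>k. X i \<notin> max_ideal_pow N"
proof -
  obtain N where N: "\<forall>k. \<exists>i\<ge>k. X i \<notin> max_ideal_pow N"
    using assms(2) unfolding adic_null_def by blast
  obtain k where k: "\<forall>i\<ge>k. \<forall>j\<ge>k. X i - X j \<in> max_ideal_pow N"
    using assms(1) unfolding adic_cauchy_def by blast
  obtain j where j: "j \<ge> k" "X j \<notin> max_ideal_pow N" using N by blast
  have "X i \<notin> max_ideal_pow N" if "i \<ge> k" for i
    using max_ideal_pow_closed(3)[of "X i" N "X i - X j"] k j that by auto
  then show ?thesis by blast
qed

lemma prime_elem_power_dvd_mult_split: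
  fixes p :: "'b::idom"
  assumes "prime_elem p" "p ^ c dvd x * y"
  shows "\<exists>i j. i + j = c \<and> p ^ i dvd x \<and> p ^ j dvd y"
  using assms(2)
proof (induction c)
  case (Suc c)
  have "p \<noteq> 0" using assms(1) by (simp add: prime_elem_def)
  have "p ^ c dvd x * y" using Suc.prems by (rule dvd_trans[rotated]) simp
  then obtain i j x' y' where ij: "i + j = c" "x = p ^ i * x'" "y = p ^ j * y'"
    using Suc.IH by (auto elim!: dvdE)
  have "p ^ c * p dvd p ^ c * (x' * y')"
    using Suc.prems unfolding ij(2,3) ij(1)[symmetric] by (simp add: power_add mult_ac)
  then have "p dvd x' * y'" using \<open>p \<noteq> 0\<close> by (simp add: dvd_mult_cancel_left)
  then consider "p dvd x'" | "p dvd y'" using assms(1) by (auto simp: prime_elem_def)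
  then show ?case
  proof cases
    case 1
    then have "p ^ Suc i dvd x" unfolding ij(2) power_Suc2 by (intro mult_dvd_mono dvd_refl)
    then show ?thesis using ij by (intro exI[of _ "Suc i"] exI[of _ j]) simp
  next
    case 2
    then have "p ^ Suc j dvd y" unfolding ij(3) power_Suc2 by (intro mult_dvd_mono dvd_refl)
    then show ?thesis using ij by (intro exI[of _ i] exI[of _ "Suc j"]) simp
  qed
qed simp

lemma adic_null_mult_cases:
  assumes "adic_cauchy X" "adic_cauchy Y" "adic_null (\<lambda>i. X i * Y i)"
  shows "adic_null X \<or> adic_null Y"
proof (rule ccontr)
  assume "\<not> ?thesis"
  then obtain N k N' k' where X: "\<And>i. i \<ge> k \<Longrightarrow> X i \<notin> max_ideal_pow N"
    and Y: "\<And>i. i \<ge> k' \<Longrightarrow> Y i \<notin> max_ideal_pow N'"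
    using adic_cauchy_not_null[OF assms(1)] adic_cauchy_not_null[OF assms(2)] by blast
  obtain t :: 'a where t: "max_ideal = {x. t dvd x}" "prime_elem t"
    by (rule max_ideal_generator)
  obtain l where l: "\<And>i. i \<ge> l \<Longrightarrow> X i * Y i \<in> max_ideal_pow (N + N')"
    using assms(3) unfolding adic_null_def by blast
  define i where "i = max l (max k k')"
  have i: "i \<ge> k" "i \<ge> k'" "i \<ge> l" unfolding i_def by auto
  have "t ^ (N + N') dvd X i * Y i" using l[OF i(3)] by (simp add: max_ideal_pow_eq[OF t(1)])
  from prime_elem_power_dvd_mult_split[OF t(2) this] obtain p q
    where pq: "p + q = N + N'" "t ^ p dvd X i" "t ^ q dvd Y i" by blast
  then have "N \<le> p \<or> N' \<le> q" by linarith
  then have "t ^ N dvd X i \<or> t ^ N' dvd Y i"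
    using pq dvd_trans le_imp_power_dvd by metis
  with X[OF i(1)] Y[OF i(2)] show False by (simp add: max_ideal_pow_eq[OF t(1)])
qed

quotient_type (overloaded) 'a completion = "nat \<Rightarrow> 'a::dvr" / partial: adic_rel
proof (rule part_equivpI)
  show "\<exists>X::nat \<Rightarrow> 'a. adic_rel X X"
    by (intro exI[of _ "\<lambda>_. 0"]) (simp add: adic_rel_def adic_cauchy_const adic_null_const)
  show "symp (adic_rel :: (nat \<Rightarrow> 'a) \<Rightarrow> _)"
  proof (rule sympI)
    fix X Y :: "nat \<Rightarrow> 'a"
    assume "adic_rel X Y"
    then show "adic_rel Y X"
      using adic_null_uminus[of "\<lambda>i. X i - Y i"] by (auto simp: adic_rel_def)
  qed
  show "transp (adic_rel :: (nat \<Rightarrow> 'a) \<Rightarrow> _)"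
  proof (rule transpI)
    fix X Y Z :: "nat \<Rightarrow> 'a"
    assume "adic_rel X Y" "adic_rel Y Z"
    then show "adic_rel X Z"
      using adic_null_add[of "\<lambda>i. X i - Y i" "\<lambda>i. Y i - Z i"] by (auto simp: adic_rel_def)
  qed
qed

lemma adic_rel_refl: "adic_rel X X \<longleftrightarrow> adic_cauchy X"
  by (auto simp: adic_rel_def adic_null_const)

instantiation completion :: (dvr) idom
begin

lift_definition zero_completion :: "'a completion" is "\<lambda>_. 0"
  by (simp add: adic_rel_refl adic_cauchy_const)

lift_definition one_completion :: "'a completion" is "\<lambda>_. 1"
  by (simp add: adic_rel_refl adic_cauchy_const)

lift_definition plus_completion :: "'a completion \<Rightarrow> 'a completion \<Rightarrow> 'a completion"
  is "\<lambda>X Y i. X i + Y i"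
proof -
  fix X X' Y Y' :: "nat \<Rightarrow> 'a"
  assume "adic_rel X X'" "adic_rel Y Y'"
  then show "adic_rel (\<lambda>i. X i + Y i) (\<lambda>i. X' i + Y' i)"
    using adic_null_add[of "\<lambda>i. X i - X' i" "\<lambda>i. Y i - Y' i"]
    by (auto simp: adic_rel_def adic_cauchy_add algebra_simps)
qed

lift_definition uminus_completion :: "'a completion \<Rightarrow> 'a completion" is "\<lambda>X i. - X i"
proof -
  fix X X' :: "nat \<Rightarrow> 'a"
  assume "adic_rel X X'"
  then show "adic_rel (\<lambda>i. - X i) (\<lambda>i. - X' i)"
    using adic_null_uminus[of "\<lambda>i. X i - X' i"] by (auto simp: adic_rel_def adic_cauchy_uminus)
qed

definition minus_completion :: "'a completion \<Rightarrow> 'a completion \<Rightarrow> 'a completion" where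
  "minus_completion x y = x + - y"

lift_definition times_completion :: "'a completion \<Rightarrow> 'a completion \<Rightarrow> 'a completion"
  is "\<lambda>X Y i. X i * Y i"
proof -
  fix X X' Y Y' :: "nat \<Rightarrow> 'a"
  assume *: "adic_rel X X'" "adic_rel Y Y'"
  have "adic_null (\<lambda>i. Y i * (X i - X' i) + X' i * (Y i - Y' i))"
    using * by (intro adic_null_add adic_null_mult) (auto simp: adic_rel_def)
  with * show "adic_rel (\<lambda>i. X i * Y i) (\<lambda>i. X' i * Y' i)"
    by (auto simp: adic_rel_def adic_cauchy_mult algebra_simps)
qed

instance
proof
  fix a b c :: "'a completion"
  note rel = adic_rel_def adic_cauchy_add adic_cauchy_mult adic_cauchy_uminus adic_cauchy_const
    adic_null_const
  show "a + b + c = a + (b + c)" by transfer (simp add: rel algebra_simps)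
  show "a + b = b + a" by transfer (simp add: rel algebra_simps)
  show "0 + a = a" by transfer (simp add: rel)
  show "- a + a = 0" by transfer (simp add: rel)
  show "a - b = a + - b" by (simp add: minus_completion_def)
  show "a * b * c = a * (b * c)" by transfer (simp add: rel algebra_simps)
  show "a * b = b * a" by transfer (simp add: rel algebra_simps)
  show "1 * a = a" by transfer (simp add: rel)
  show "(a + b) * c = a * c + b * c" by transfer (simp add: rel algebra_simps)
  show "a * (b + c) = a * b + a * c" by transfer (simp add: rel algebra_simps)
  show "0 * a = 0" by transfer (simp add: rel)
  show "a * 0 = 0" by transfer (simp add: rel)
  show "(0::'a completion) \<noteq> 1"
  proof (transfer, unfold adic_rel_def, safe)
    assume *: "adic_null (\<lambda>i. 0 - 1 :: 'a)"
    obtain t :: 'a where t: "max_ideal = {x. t dvd x}" "prime_elem t"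
      by (rule max_ideal_generator)
    from * have "(0 - 1 :: 'a) \<in> max_ideal_pow 1" unfolding adic_null_def by blast
    then have "t dvd 0 - 1" unfolding max_ideal_pow_eq[OF t(1)] by simp
    then show False using t(2) by (simp add: prime_elem_def)
  qed
  have "a * b = 0 \<Longrightarrow> a = 0 \<or> b = 0"
  proof transfer
    fix X Y :: "nat \<Rightarrow> 'a"
    assume "adic_rel X X" "adic_rel Y Y" "adic_rel (\<lambda>i. X i * Y i) (\<lambda>_. 0)"
    then show "adic_rel X (\<lambda>_. 0) \<or> adic_rel Y (\<lambda>_. 0)"
      using adic_null_mult_cases[of X Y] by (simp add: adic_rel_def)
  qed
  then show "a \<noteq> 0 \<Longrightarrow> b \<noteq> 0 \<Longrightarrow> a * b \<noteq> 0" by blast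
qed

end

text \<open>The limit in the completion of a Cauchy sequence; other sequences are mapped to \<open>0\<close>.\<close>

lift_definition of_seq :: "(nat \<Rightarrow> 'a) \<Rightarrow> 'a::dvr completion"
  is "\<lambda>X. if adic_cauchy X then X else (\<lambda>_. 0)"
  by (simp add: adic_rel_refl adic_cauchy_const)

text \<open>All rings are subrings of the field of fractions \<open>'a completion fract\<close> of the completion of
  the discrete valuation ring \<open>'a\<close>.\<close>

definition emb :: "'a::dvr \<Rightarrow> 'a completion fract" where
  "emb x = Fract (of_seq (\<lambda>_. x)) 1"

definition ring_A :: "'a::dvr completion fract set" where
  "ring_A = range emb"

definition ring_Ahat :: "'a::dvr completion fract set" where
  "ring_Ahat = range (\<lambda>x. Fract x 1)"

definition field_K :: "'a::dvr completion fract set" where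
  "field_K = localize ring_A (ring_A - {0})"

abbreviation K_mod_A :: "'a::dvr completion fract set set" where
  "K_mod_A \<equiv> quot field_K ring_A"

definition transcendental_over_A :: "'a::dvr completion fract \<Rightarrow> bool" where
  "transcendental_over_A z \<longleftrightarrow> (\<forall>p::'a poly. p \<noteq> 0 \<longrightarrow> poly (map_poly emb p) z \<noteq> 0)"

text \<open>The element \<open>z\<^sub>r\<close>, as the limit of the partial sums of its series. They form a Cauchy sequence
  when \<open>n\<close> is strictly increasing and \<open>t\<close> is not a unit; the subtraction in the exponent then does
  not truncate either. The element \<open>z\<close> is \<open>z\<^sub>0\<close> when \<open>n 0 = 0\<close>.\<close>

definition z_elt :: "'a::dvr \<Rightarrow> (nat \<Rightarrow> 'a) \<Rightarrow> (nat \<Rightarrow> nat) \<Rightarrow> nat \<Rightarrow> 'a completion fract" where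
  "z_elt t a n r = Fract (of_seq (\<lambda>k. \<Sum>i<k. a (r + i) * t ^ (n (r + i) - n r))) 1"

definition tau :: "'a::dvr \<Rightarrow> (nat \<Rightarrow> 'a) \<Rightarrow> (nat \<Rightarrow> nat) \<Rightarrow> 'a completion fract" where
  "tau t a n = emb t * (z_elt t a n 0 - emb (a 0))"

definition ring_C :: "'a::dvr \<Rightarrow> (nat \<Rightarrow> 'a) \<Rightarrow> (nat \<Rightarrow> nat) \<Rightarrow> 'a completion fract set" where
  "ring_C t a n =
     subring_span (ring_A \<union> {tau t a n} \<union> {(z_elt t a n i - emb (a i))\<^sup>2 | i. True})"

definition ideal_M :: "'a::dvr \<Rightarrow> (nat \<Rightarrow> 'a) \<Rightarrow> (nat \<Rightarrow> nat) \<Rightarrow> 'a completion fract set" where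
  "ideal_M t a n = ideal_span (ring_C t a n) {emb t, tau t a n}"

definition ring_CM :: "'a::dvr \<Rightarrow> (nat \<Rightarrow> 'a) \<Rightarrow> (nat \<Rightarrow> nat) \<Rightarrow> 'a completion fract set" where
  "ring_CM t a n = localize (ring_C t a n) (ring_C t a n - ideal_M t a n)"

text \<open>The first local cohomology module of \<open>C\<^sub>M\<close> at its maximal ideal is identified with
  \<open>(C\<^sub>M)\<^sub>t / C\<^sub>M\<close>.\<close>

definition H1 :: "'a::dvr \<Rightarrow> (nat \<Rightarrow> 'a) \<Rightarrow> (nat \<Rightarrow> nat) \<Rightarrow> 'a completion fract set set" where
  "H1 t a n = quot (localize (ring_CM t a n) {emb t ^ k | k. True}) (ring_CM t a n)"

definition gfrac_CM :: "'a::dvr \<Rightarrow> (nat \<Rightarrow> 'a) \<Rightarrow> (nat \<Rightarrow> nat) \<Rightarrow>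
    'a completion fract \<Rightarrow> nat \<Rightarrow> 'a completion fract set" where
  "gfrac_CM t a n f k = (f / emb t ^ k) +o ring_CM t a n"

text \<open>The canonical isomorphism from \<open>K/A\<close> to the quotient by the completion sends the coset
  \<open>x + A\<close> to the coset of \<open>x\<close> modulo the completion, which is the sum of the two sets
  \<open>x + A\<close> and \<open>ring_Ahat\<close>.\<close>

definition gfrac_A :: "'a::dvr \<Rightarrow> 'a completion fract \<Rightarrow> nat \<Rightarrow> 'a completion fract set" where
  "gfrac_A t f k = inv_into K_mod_A (\<lambda>c. c + ring_Ahat) ((f / emb t ^ k) +o ring_Ahat)"

text \<open>For \<open>\<sigma>, \<rho>\<close> in the completion, the value does not depend on the representation of \<open>\<omega>\<close>.\<close>

definition res :: "'a::dvr \<Rightarrow> (nat \<Rightarrow> 'a) \<Rightarrow> (nat \<Rightarrow> nat) \<Rightarrow> 'a completion fract \<Rightarrow>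
    'a completion fract \<Rightarrow> 'a completion fract set \<Rightarrow> 'a completion fract set" where
  "res t a n \<sigma> \<rho> \<omega> = (THE c. \<exists>X\<in>ring_A. \<exists>Y\<in>ring_A. \<exists>k>0.
     \<omega> = gfrac_CM t a n (X + Y * tau t a n) k \<and> c = gfrac_A t (X * \<sigma> + Y * \<rho>) k)"

text \<open>Homomorphisms are normalised to be \<open>undefined\<close> outside their domain, so that they can be
  compared by equality.\<close>

definition Hom_A_K_mod_A :: "'a::dvr completion fract set \<Rightarrow>
    ('a completion fract \<Rightarrow> 'a completion fract set) set" where
  "Hom_A_K_mod_A N = {\<phi> \<in> N \<rightarrow>\<^sub>E K_mod_A.
     (\<forall>f\<in>N. \<forall>g\<in>N. \<phi> (f + g) = \<phi> f + \<phi> g) \<and>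
     (\<forall>x\<in>ring_A. \<forall>f\<in>N. \<phi> (x * f) = quot_scale ring_A x (\<phi> f))}"

text \<open>In the continuity condition, \<open>ring_A\<close> is the zero element of \<open>K/A\<close>.\<close>

definition Homc :: "'a::dvr \<Rightarrow> (nat \<Rightarrow> 'a) \<Rightarrow> (nat \<Rightarrow> nat) \<Rightarrow>
    ('a completion fract \<Rightarrow> 'a completion fract set) set" where
  "Homc t a n = {\<phi> \<in> Hom_A_K_mod_A (ring_CM t a n). \<exists>k.
     \<forall>f \<in> ideal_span (ring_CM t a n) (ideal_pow (ring_C t a n) (ideal_M t a n) k).
       \<phi> f = ring_A}"

definition linear_maps_H1_Homc :: "'a::dvr \<Rightarrow> (nat \<Rightarrow> 'a) \<Rightarrow> (nat \<Rightarrow> nat) \<Rightarrow>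
    ('a completion fract set \<Rightarrow> 'a completion fract \<Rightarrow> 'a completion fract set) set" where
  "linear_maps_H1_Homc t a n = {\<Phi> \<in> H1 t a n \<rightarrow>\<^sub>E Homc t a n.
     (\<forall>\<omega>\<in>H1 t a n. \<forall>\<omega>'\<in>H1 t a n.
        \<Phi> (\<omega> + \<omega>') = (\<lambda>f\<in>ring_CM t a n. \<Phi> \<omega> f + \<Phi> \<omega>' f)) \<and>
     (\<forall>g\<in>ring_CM t a n. \<forall>\<omega>\<in>H1 t a n.
        \<Phi> (quot_scale (ring_CM t a n) g \<omega>) = (\<lambda>f\<in>ring_CM t a n. \<Phi> \<omega> (g * f)))}"

definition Phi_res :: "'a::dvr \<Rightarrow> (nat \<Rightarrow> 'a) \<Rightarrow> (nat \<Rightarrow> nat) \<Rightarrow> 'a completion fract \<Rightarrow>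
    'a completion fract \<Rightarrow> 'a completion fract set \<Rightarrow> 'a completion fract \<Rightarrow>
    'a completion fract set" where
  "Phi_res t a n \<sigma> \<rho> =
     (\<lambda>\<omega>\<in>H1 t a n. \<lambda>f\<in>ring_CM t a n. res t a n \<sigma> \<rho> (quot_scale (ring_CM t a n) f \<omega>))"

end

theory Submission
  imports Defs
begin

text \<open>Evaluation at \<open>1\<close> turns \<open>\<Phi>\<close> into the \<open>A\<close>-linear map \<open>\<psi>(\<omega>) = \<Phi>(\<omega>)(1)\<close> from the local
  cohomology to \<open>K/A\<close>, and \<open>\<Phi>\<close> is recovered from \<open>\<Phi>(\<omega>)(f) = \<psi>(f\<omega>)\<close>. As \<open>C\<^sub>M = A + A\<tau> + t\<^sup>kC\<^sub>M\<close> for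
  every \<open>k\<close>, where \<open>\<tau> = t(z\<^sub>0 - a\<^sub>0)\<close>, the map \<open>\<psi>\<close> is determined by its values at the classes of
  \<open>1/t\<^sup>k\<close> and \<open>\<tau>/t\<^sup>k\<close>. Write the value at \<open>1/t\<^sup>k\<close> as the class of \<open>s\<^sub>k/t\<^sup>k\<close>: linearity makes
  \<open>(s\<^sub>k)\<close> a Cauchy sequence, and its limit is \<open>\<sigma>\<close>; the values at \<open>\<tau>/t\<^sup>k\<close> give \<open>\<rho>\<close> in the same way.
  Since \<open>\<psi>\<close> then agrees with the formula for the residue on every representation of a class, the
  residue of that class is well defined and equal to the value of \<open>\<psi>\<close>.\<close>

section \<open>Subrings, generated ideals and cosets\<close>

text \<open>The closure condition is the one in \<open>subring_span\<close>, so that a span is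
  contained in any subring that contains the generators.\<close>

definition is_subring :: "'b::comm_ring_1 set \<Rightarrow> bool" where
  "is_subring R \<longleftrightarrow> 1 \<in> R \<and> (\<forall>x\<in>R. \<forall>y\<in>R. x - y \<in> R \<and> x * y \<in> R)"

lemma is_subringD:
  assumes "is_subring R"
  shows is_subring_one: "1 \<in> R"
    and is_subring_zero: "0 \<in> R"
    and is_subring_diff: "x \<in> R \<Longrightarrow> y \<in> R \<Longrightarrow> x - y \<in> R"
    and is_subring_mult: "x \<in> R \<Longrightarrow> y \<in> R \<Longrightarrow> x * y \<in> R"
    and is_subring_uminus: "x \<in> R \<Longrightarrow> - x \<in> R"
    and is_subring_add: "x \<in> R \<Longrightarrow> y \<in> R \<Longrightarrow> x + y \<in> R"
    and is_subring_power: "x \<in> R \<Longrightarrow> x ^ k \<in> R"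
proof -
  show 1: "1 \<in> R" and diff: "\<And>x y. x \<in> R \<Longrightarrow> y \<in> R \<Longrightarrow> x - y \<in> R"
    and mult: "\<And>x y. x \<in> R \<Longrightarrow> y \<in> R \<Longrightarrow> x * y \<in> R"
    using assms by (auto simp: is_subring_def)
  show 0: "0 \<in> R" using diff[OF 1 1] by simp
  show uminus: "- x \<in> R" if "x \<in> R" for x using diff[OF 0 that] by simp
  show "x + y \<in> R" if "x \<in> R" "y \<in> R" for x y
    using diff[OF that(1) uminus[OF that(2)]] by simp
  show "x ^ k \<in> R" if "x \<in> R" by (induction k) (auto intro: 1 mult that)
qed

lemma subring_span_superset: "S \<subseteq> subring_span S"
  by (auto simp: subring_span_def)

lemma is_subring_subring_span: "is_subring (subring_span S)"
  by (auto simp: subring_span_def is_subring_def)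

lemma subring_span_least: "S \<subseteq> R \<Longrightarrow> is_subring R \<Longrightarrow> subring_span S \<subseteq> R"
  unfolding subring_span_def is_subring_def by (rule Inter_lower) blast

lemma ideal_span_superset: "S \<subseteq> ideal_span R S"
  by (auto simp: ideal_span_def)

lemma ideal_span_zero: "0 \<in> ideal_span R S"
  and ideal_span_add: "x \<in> ideal_span R S \<Longrightarrow> y \<in> ideal_span R S \<Longrightarrow> x + y \<in> ideal_span R S"
  and ideal_span_mult: "r \<in> R \<Longrightarrow> x \<in> ideal_span R S \<Longrightarrow> r * x \<in> ideal_span R S"
  unfolding ideal_span_def by blast+

lemma ideal_span_least:
  assumes "S \<subseteq> I" "0 \<in> I" "\<And>x y. x \<in> I \<Longrightarrow> y \<in> I \<Longrightarrow> x + y \<in> I"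
    "\<And>r x. r \<in> R \<Longrightarrow> x \<in> I \<Longrightarrow> r * x \<in> I"
  shows "ideal_span R S \<subseteq> I"
  unfolding ideal_span_def by (rule Inter_lower) (use assms in blast)

lemma coset_eq_iff:
  assumes "is_subring R"
  shows "x +o R = y +o R \<longleftrightarrow> x - y \<in> R"
proof
  assume eq: "x +o R = y +o R"
  have "x \<in> x +o R" using is_subring_zero[OF assms] by (force simp: elt_set_plus_def)
  then obtain r where "r \<in> R" "x = y + r" unfolding eq by (auto simp: elt_set_plus_def)
  then show "x - y \<in> R" by simp
next
  assume *: "x - y \<in> R"
  show "x +o R = y +o R"
  proof (intro set_eqI iffI)
    fix u assume "u \<in> x +o R"
    then obtain r where "r \<in> R" "u = x + r" by (auto simp: elt_set_plus_def)
    then have "(x - y) + r \<in> R" "u = y + ((x - y) + r)"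
      using is_subring_add[OF assms *] by auto
    then show "u \<in> y +o R" unfolding elt_set_plus_def by blast
  next
    fix u assume "u \<in> y +o R"
    then obtain r where "r \<in> R" "u = y + r" by (auto simp: elt_set_plus_def)
    then have "r - (x - y) \<in> R" "u = x + (r - (x - y))"
      using is_subring_diff[OF assms _ *] by auto
    then show "u \<in> x +o R" unfolding elt_set_plus_def by blast
  qed
qed

text \<open>This computes the map K/A to \<open>K\<close>-hat modulo \<open>ring_Ahat\<close> in the
  encoding of \<open>gfrac_A\<close>, where a coset is sent to its sum with
  \<open>ring_Ahat\<close>. The case \<open>R' = R\<close> gives \<open>R + R = R\<close>.\<close>

lemma coset_plus_superring:
  assumes "is_subring R" "is_subring R'" "R \<subseteq> R'"
  shows "(x +o R) + R' = x +o R'"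
proof (intro set_eqI iffI)
  fix u assume "u \<in> (x +o R) + R'"
  then obtain r s where "r \<in> R" "s \<in> R'" "u = x + (r + s)"
    by (auto simp: elt_set_plus_def set_plus_def add_ac)
  then show "u \<in> x +o R'"
    using is_subring_add[OF assms(2)] assms(3) unfolding elt_set_plus_def by blast
next
  fix u assume "u \<in> x +o R'"
  then obtain s where "s \<in> R'" "u = (x + 0) + s" by (auto simp: elt_set_plus_def)
  then show "u \<in> (x +o R) + R'"
    using is_subring_zero[OF assms(1)] unfolding elt_set_plus_def set_plus_def by blast
qed

lemma coset_plus:
  assumes "is_subring R"
  shows "(x +o R) + (y +o R) = (x + y) +o R"
proof -
  have "R + R = R"
    using coset_plus_superring[OF assms assms, of 0] by (simp add: elt_set_plus_def)
  then show ?thesis by (simp add: set_plus_rearrange)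
qed

lemma quot_scale_coset:
  assumes "is_subring R" "r \<in> R"
  shows "quot_scale R r (x +o R) = (r * x) +o R"
proof (intro set_eqI iffI)
  fix u assume "u \<in> quot_scale R r (x +o R)"
  then obtain p q where "p \<in> R" "q \<in> R" "u = r * x + (r * p + q)"
    by (auto simp: quot_scale_def elt_set_plus_def elt_set_times_def set_plus_def algebra_simps)
  then show "u \<in> (r * x) +o R"
    using is_subring_add[OF assms(1)] is_subring_mult[OF assms] unfolding elt_set_plus_def
    by blast
next
  fix u assume "u \<in> (r * x) +o R"
  then obtain q where "q \<in> R" "u = r * (x + 0) + q" by (auto simp: elt_set_plus_def)
  then show "u \<in> quot_scale R r (x +o R)"
    using is_subring_zero[OF assms(1)]
    unfolding quot_scale_def elt_set_plus_def elt_set_times_def set_plus_def by blast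
qed

section \<open>Limits in the completion\<close>

lemma of_seq_add:
  "adic_cauchy X \<Longrightarrow> adic_cauchy Y \<Longrightarrow> of_seq X + of_seq Y = of_seq (\<lambda>i. X i + Y i)"
  by transfer (simp add: adic_rel_refl adic_cauchy_add adic_cauchy_const)

lemma of_seq_mult:
  "adic_cauchy X \<Longrightarrow> adic_cauchy Y \<Longrightarrow> of_seq X * of_seq Y = of_seq (\<lambda>i. X i * Y i)"
  by transfer (simp add: adic_rel_refl adic_cauchy_mult adic_cauchy_const)

lemma of_seq_eq_iff:
  "adic_cauchy X \<Longrightarrow> adic_cauchy Y \<Longrightarrow> of_seq X = of_seq Y \<longleftrightarrow> adic_null (\<lambda>i. X i - Y i)"
  by transfer (simp add: adic_rel_def)

lemma of_seq_surj:
  obtains X where "adic_cauchy X" "x = of_seq X"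
proof -
  obtain X where X: "adic_cauchy X" "x = abs_completion X"
    by (induction x) (auto simp: adic_rel_def)
  then have "x = of_seq X" by (simp add: of_seq.abs_eq)
  with X that show thesis by blast
qed

lemma of_seq_shift:
  assumes "adic_cauchy X"
  shows "adic_cauchy (\<lambda>i. X (Suc i))" "of_seq (\<lambda>i. X (Suc i)) = of_seq X"
proof -
  show *: "adic_cauchy (\<lambda>i. X (Suc i))"
    using assms unfolding adic_cauchy_def by (meson le_SucI)
  have "adic_null (\<lambda>i. X (Suc i) - X i)"
    using assms unfolding adic_cauchy_def adic_null_def by (meson le_SucI)
  then show "of_seq (\<lambda>i. X (Suc i)) = of_seq X" using of_seq_eq_iff[OF * assms] by blast
qed

text \<open>All steps from index \<open>N\<close> on are divisible by \<open>t ^ N\<close>, so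
  telescoping back to \<open>X N\<close> bounds every later difference.\<close>

lemma adic_cauchyI_Suc:
  fixes t :: "'a::dvr"
  assumes t: "max_ideal = {x. t dvd x}" and X: "\<And>i. t ^ i dvd X (Suc i) - X i"
  shows "adic_cauchy X"
  unfolding adic_cauchy_def max_ideal_pow_eq[OF t]
proof
  fix N
  have *: "t ^ N dvd X i - X N" if "i \<ge> N" for i
    using that
  proof (induction i rule: dec_induct)
    case (step i)
    have "t ^ N dvd X (Suc i) - X i" using X le_imp_power_dvd[OF step(1)] dvd_trans by blast
    with step.IH have "t ^ N dvd (X (Suc i) - X i) + (X i - X N)" by (rule dvd_add[rotated])
    then show ?case by simp
  qed simp
  have "t ^ N dvd X i - X j" if "i \<ge> N" "j \<ge> N" for i j
    using dvd_diff[OF *[OF that(1)] *[OF that(2)]] by simp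
  then show "\<exists>k. \<forall>i\<ge>k. \<forall>j\<ge>k. X i - X j \<in> {x. t ^ N dvd x}" by blast
qed

text \<open>The \<open>k\<close>-th term agrees with the limit modulo \<open>t ^ k\<close>: the
  differences \<open>X (i + k) - X k\<close> are divisible by \<open>t ^ k\<close>, and their
  quotients \<open>b i\<close> satisfy the same step condition. Hence \<open>b\<close> is Cauchy,
  and its limit is \<open>c\<close>.\<close>

lemma limit_approx:
  fixes t :: "'a::dvr"
  assumes t: "max_ideal = {x. t dvd x}" "t \<noteq> 0" and X: "\<And>i. t ^ i dvd X (Suc i) - X i"
  shows "\<exists>c. of_seq X = of_seq (\<lambda>_. X k) + of_seq (\<lambda>_. t ^ k) * c"
proof -
  have "t ^ k dvd X (i + k) - X k" for i
  proof (induction i)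
    case (Suc i)
    have "t ^ k dvd X (Suc (i + k)) - X (i + k)"
      using X le_imp_power_dvd[of k "i + k"] dvd_trans by (metis le_add2)
    from dvd_add[OF this Suc] show ?case by simp
  qed simp
  then obtain b where b: "\<And>i. X (i + k) - X k = t ^ k * b i" unfolding dvd_def by metis
  have "t ^ i dvd b (Suc i) - b i" for i
  proof -
    have "t ^ k * (b (Suc i) - b i) = X (Suc (i + k)) - X (i + k)"
      using b[of i] b[of "Suc i"] by (simp add: algebra_simps)
    then have "t ^ k * t ^ i dvd t ^ k * (b (Suc i) - b i)"
      using X[of "i + k"] by (simp add: power_add mult.commute)
    then show ?thesis using t(2) by (simp add: dvd_mult_cancel_left)
  qed
  then have "adic_cauchy b" by (rule adic_cauchyI_Suc[OF t(1)])
  note cauchy = this adic_cauchy_const adic_cauchyI_Suc[OF t(1) X]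
  have shift: "adic_cauchy (\<lambda>i. X (i + j)) \<and> of_seq (\<lambda>i. X (i + j)) = of_seq X" for j
  proof (induction j)
    case (Suc j)
    then show ?case using of_seq_shift[of "\<lambda>i. X (i + j)"] by simp
  qed (simp add: cauchy)
  have "X (i + k) = X k + t ^ k * b i" for i using b[of i] by (simp add: algebra_simps)
  then have "of_seq X = of_seq (\<lambda>_. X k) + of_seq (\<lambda>_. t ^ k) * of_seq b"
    using shift[of k] by (simp add: of_seq_add of_seq_mult cauchy adic_cauchy_mult)
  then show ?thesis ..
qed

section \<open>Separatedness of A and descent of divisibility from its completion\<close>

text \<open>Krull's intersection theorem. The intersection of the powers is principal, say generated
  by \<open>g = t * h\<close>; cancelling \<open>t\<close> puts \<open>h\<close> in the intersection
  too, so \<open>g\<close> divides \<open>h\<close> and h = t h r. As \<open>t\<close> is not a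
  unit, \<open>h\<close> vanishes.\<close>

lemma max_ideal_pow_Inter:
  fixes t :: "'a::dvr"
  assumes t: "max_ideal = {x. t dvd x}" "t \<noteq> 0" and x: "\<And>N. t ^ N dvd x"
  shows "x = 0"
proof -
  have "\<exists>g. {x. \<forall>N. t ^ N dvd x} = {x. g dvd x}"
    by (rule principal) auto
  then obtain g where g: "{x. \<forall>N. t ^ N dvd x} = {x. g dvd x}" by blast
  then have gN: "t ^ N dvd g" for N by auto
  from gN[of 1] obtain h where h: "g = t * h" by (auto elim: dvdE)
  have "t ^ N dvd h" for N using gN[of "Suc N"] t(2) by (simp add: h dvd_mult_cancel_left)
  then have "g dvd h" using g by blast
  then obtain r where r: "h = g * r" by (rule dvdE)
  have "\<not> t dvd 1" using t(1) by (force simp: max_ideal_def)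
  have "h * (1 - t * r) = 0" using r h by (simp add: algebra_simps)
  moreover have "1 - t * r \<noteq> 0" using \<open>\<not> t dvd 1\<close> by (metis dvd_triv_left eq_iff_diff_eq_0)
  ultimately have "g = 0" using h by simp
  moreover have "g dvd x" using x g by blast
  ultimately show ?thesis by simp
qed

text \<open>If \<open>y\<close> is \<open>t ^ v\<close> times a unit, divisibility by
  \<open>y\<close> only concerns residues modulo \<open>t ^ v\<close>, and there \<open>g\<close>
  may be replaced by a term \<open>G i\<close> of a sequence converging to it.\<close>

lemma dvd_of_completion_dvd:
  fixes t x y :: "'a::dvr"
  assumes t: "max_ideal = {x. t dvd x}" "t \<noteq> 0" and y: "y \<noteq> 0"
    and g: "of_seq (\<lambda>_. y) * g = of_seq (\<lambda>_. x)"
  shows "y dvd x"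
proof -
  \<comment> \<open>\<open>v\<close> is the valuation of \<open>y\<close>; it exists because a
    nonzero element does not lie in all powers of the maximal ideal.\<close>
  have "\<exists>N. \<not> t ^ N dvd y" using max_ideal_pow_Inter[OF t] y by blast
  then obtain v where v: "t ^ v dvd y" "\<not> t ^ Suc v dvd y"
    using exists_least_lemma[of "\<lambda>N. \<not> t ^ N dvd y"] by auto
  from v(1) obtain u where u: "y = t ^ v * u" by (auto elim: dvdE)
  have "\<not> t dvd u" using v(2) by (auto simp: u mult.commute intro: mult_dvd_mono)
  then have "u dvd 1" using t(1) by (auto simp: max_ideal_def)
  obtain G where G: "adic_cauchy G" "g = of_seq G" by (rule of_seq_surj)
  have "of_seq (\<lambda>i. y * G i) = of_seq (\<lambda>_. x)"
    using g G by (simp add: of_seq_mult adic_cauchy_const)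
  then have "adic_null (\<lambda>i. y * G i - x)"
    using G by (simp add: of_seq_eq_iff adic_cauchy_mult adic_cauchy_const)
  then obtain i where "t ^ v dvd y * G i - x"
    unfolding adic_null_def max_ideal_pow_eq[OF t(1)] by blast
  with v(1) have "t ^ v dvd y * G i - (y * G i - x)" by (meson dvd_diff dvd_mult2)
  then have "t ^ v dvd x" by (simp only: diff_diff_eq2 add_diff_cancel_left')
  then have "t ^ v * u dvd x * 1" using \<open>u dvd 1\<close> by (rule mult_dvd_mono)
  then show ?thesis by (simp add: u)
qed

section \<open>The rings inside the field of fractions of the completion\<close>

lemma emb_add: "emb (x + y) = emb x + emb y"
  by (simp add: emb_def of_seq_add adic_cauchy_const)

lemma emb_mult: "emb (x * y) = emb x * emb y"
  by (simp add: emb_def of_seq_mult adic_cauchy_const)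

lemma emb_0: "emb 0 = 0"
proof -
  have "emb 0 + emb 0 = emb 0 + (0 :: 'a completion fract)"
    by (simp only: emb_add[symmetric] add_0_right)
  then show ?thesis by (simp only: add_left_cancel)
qed

lemma emb_1: "emb 1 = 1"
proof -
  have "of_seq (\<lambda>_. 1) = (1 :: 'a completion)"
    by transfer (simp add: adic_rel_refl adic_cauchy_const)
  then show ?thesis by (simp add: emb_def One_fract_def)
qed

lemma emb_diff: "emb (x - y) = emb x - emb y"
  using emb_add[of "x - y" y] by simp

lemma emb_power: "emb (x ^ k) = emb x ^ k"
  by (induction k) (simp_all add: emb_1 emb_mult)

lemma is_subring_ring_A: "is_subring ring_A"
  unfolding is_subring_def ring_A_def
  by (auto simp flip: emb_diff emb_mult emb_1)

lemma is_subring_ring_Ahat: "is_subring ring_Ahat"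
  unfolding is_subring_def ring_Ahat_def
  by (auto simp: One_fract_def)

lemma ring_A_subset_ring_Ahat: "ring_A \<subseteq> ring_Ahat"
  by (auto simp: ring_A_def ring_Ahat_def emb_def)

lemma emb_in_ring_A: "emb x \<in> ring_A"
  by (simp add: ring_A_def)

lemma emb_in_ring_Ahat: "emb x \<in> ring_Ahat"
  using emb_in_ring_A ring_A_subset_ring_Ahat by blast

lemma z_elt_in_ring_Ahat: "z_elt t a n r \<in> ring_Ahat"
  by (simp add: z_elt_def ring_Ahat_def)

locale akizuki =
  fixes t :: "'a::dvr" and a :: "nat \<Rightarrow> 'a" and n :: "nat \<Rightarrow> nat"
  assumes t: "max_ideal = {x. t dvd x}"
    and n_0: "n 0 = 0"
    and n_step: "\<And>r. r \<ge> 1 \<Longrightarrow> n r \<ge> 2 * n (r - 1) + 2"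
begin

lemma unit_iff: "x dvd 1 \<longleftrightarrow> \<not> t dvd x"
proof -
  have "x \<in> max_ideal \<longleftrightarrow> t dvd x" unfolding t by simp
  then show ?thesis unfolding max_ideal_def by blast
qed

lemma t_not_unit: "\<not> t dvd 1"
  by (simp add: unit_iff)

lemma t_nonzero: "t \<noteq> 0"
proof -
  obtain x :: 'a where x: "x \<noteq> 0" "\<not> x dvd 1" using not_field by blast
  then have "t dvd x" using unit_iff by blast
  with x(1) show ?thesis by auto
qed

lemma n_Suc: "n (Suc r) \<ge> 2 * n r + 2"
  using n_step[of "Suc r"] by simp

abbreviation "e \<equiv> emb t"
abbreviation "C \<equiv> ring_C t a n"
abbreviation "M \<equiv> ideal_M t a n"
abbreviation "CM \<equiv> ring_CM t a n"
abbreviation "\<tau> \<equiv> tau t a n"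
abbreviation "w i \<equiv> z_elt t a n i - emb (a i)"

lemma emb_eq_0_iff: "emb x = 0 \<longleftrightarrow> x = 0" for x :: 'a
proof
  assume "emb x = 0"
  then have "of_seq (\<lambda>_. x) = 0" by (simp add: emb_def Zero_fract_def eq_fract)
  moreover have "of_seq (\<lambda>_. 0) = (0 :: 'a completion)"
    by transfer (simp add: adic_rel_refl adic_cauchy_const)
  ultimately have "of_seq (\<lambda>_. x) = of_seq (\<lambda>_. 0)" by simp
  then have "adic_null (\<lambda>_. x - 0)"
    by (rule iffD1[OF of_seq_eq_iff[OF adic_cauchy_const adic_cauchy_const]])
  then have "adic_null (\<lambda>_. x)" by (simp only: diff_zero)
  then have "x \<in> max_ideal_pow N" for N unfolding adic_null_def by blast
  then have "t ^ N dvd x" for N by (simp add: max_ideal_pow_eq[OF t])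
  then show "x = 0" by (rule max_ideal_pow_Inter[OF t t_nonzero])
qed (simp add: emb_0)

lemma e_nonzero: "e \<noteq> 0"
  by (simp add: emb_eq_0_iff t_nonzero)

text \<open>Clearing the denominator turns membership in both rings into a divisibility in the
  completion, which descends to A. This is the injectivity of the canonical map out of K/A.\<close>

lemma field_K_Int_ring_Ahat:
  assumes "x \<in> field_K" "x \<in> ring_Ahat"
  shows "x \<in> (ring_A :: 'a completion fract set)"
proof -
  obtain p q where pq: "x = emb p / emb q" "emb q \<noteq> 0"
    using assms(1) by (auto simp: field_K_def localize_def ring_A_def)
  obtain g where g: "x = Fract g 1" using assms(2) by (auto simp: ring_Ahat_def)
  have "emb q * x = emb p" using pq by simp
  then have "of_seq (\<lambda>_. q) * g = of_seq (\<lambda>_. p)"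
    by (simp add: g emb_def eq_fract)
  then have "q dvd p" using pq(2) dvd_of_completion_dvd[OF t t_nonzero] emb_0 by metis
  then obtain r where "p = q * r" by (rule dvdE)
  then have "x = emb r" using pq by (simp add: emb_mult)
  then show ?thesis by (simp add: ring_A_def)
qed

lemma field_K_divide: "x \<in> ring_A \<Longrightarrow> x / e ^ k \<in> field_K"
  using is_subring_power[OF is_subring_ring_A emb_in_ring_A, of t k] e_nonzero
  unfolding field_K_def localize_def by force

text \<open>Otherwise 1/t would lie in K and in \<open>ring_Ahat\<close>, hence in A, and
  \<open>t\<close> would be a unit.\<close>

lemma one_not_in_e_Ahat: "c \<in> ring_Ahat \<Longrightarrow> e * c \<noteq> 1"
proof
  assume c: "c \<in> ring_Ahat" "e * c = 1"
  then have "c = 1 / e ^ 1" using e_nonzero by (simp add: field_simps)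
  then have "c \<in> ring_A"
    using field_K_Int_ring_Ahat c(1) field_K_divide is_subring_one[OF is_subring_ring_A] by metis
  then obtain r where "c = emb r" by (auto simp: ring_A_def)
  then have "emb (t * r - 1) = 0" using c(2) by (simp add: emb_mult emb_diff emb_1)
  then have "t * r = 1" by (simp add: emb_eq_0_iff)
  then show False using t_not_unit by (metis dvd_triv_left)
qed

text \<open>The canonical map out of K/A is injective, so its \<open>inv_into\<close> can be
  evaluated at a coset as soon as a representative \<open>y\<close> in K is known.\<close>

lemma gfrac_A_eqI:
  assumes "y \<in> field_K" "y - f / e ^ k \<in> ring_Ahat"
  shows "gfrac_A t f k = y +o ring_A"
proof -
  note plus = coset_plus_superring[OF is_subring_ring_A is_subring_ring_Ahat
      ring_A_subset_ring_Ahat]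
  have K_diff: "u - v \<in> field_K" if uv: "u \<in> field_K" "v \<in> field_K"
    for u v :: "'a completion fract"
  proof -
    obtain p q p' q' where *: "u = p / q" "v = p' / q'" "p \<in> ring_A" "q \<in> ring_A"
      "p' \<in> ring_A" "q' \<in> ring_A" "q \<noteq> 0" "q' \<noteq> 0"
      using uv unfolding field_K_def localize_def by blast
    have "u - v = (p * q' - q * p') / (q * q')"
      unfolding *(1,2) diff_frac_eq[OF *(7,8)] by (simp add: mult.commute)
    moreover have "p * q' - q * p' \<in> ring_A" "q * q' \<in> ring_A - {0}"
      using * by (auto intro!: is_subringD[OF is_subring_ring_A])
    ultimately show ?thesis unfolding field_K_def localize_def by blast
  qed
  have "inj_on (\<lambda>c. c + ring_Ahat) (K_mod_A :: 'a completion fract set set)"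
  proof (rule inj_onI)
    fix c d :: "'a completion fract set"
    assume "c \<in> K_mod_A" "d \<in> K_mod_A" and eq: "c + ring_Ahat = d + ring_Ahat"
    then obtain u v where uv: "c = u +o ring_A" "d = v +o ring_A" "u \<in> field_K" "v \<in> field_K"
      by (auto simp: quot_def)
    then have "u - v \<in> ring_Ahat"
      using eq by (simp add: plus coset_eq_iff[OF is_subring_ring_Ahat])
    then have "u - v \<in> ring_A" using K_diff uv field_K_Int_ring_Ahat by blast
    then show "c = d" using uv by (simp add: coset_eq_iff[OF is_subring_ring_A])
  qed
  moreover have "y +o ring_A \<in> K_mod_A" using assms by (auto simp: quot_def)
  ultimately have "inv_into K_mod_A (\<lambda>c. c + ring_Ahat) (y +o ring_A + ring_Ahat) = y +o ring_A"
    by (rule inv_into_f_f)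
  moreover have "y +o ring_A + ring_Ahat = (f / e ^ k) +o ring_Ahat"
    using assms by (simp add: plus coset_eq_iff[OF is_subring_ring_Ahat])
  ultimately show ?thesis by (simp add: gfrac_A_def)
qed

section \<open>The structure of Akizuki's ring\<close>

text \<open>The first summand is split off the partial sums; what remains are the partial sums for
  \<open>Suc r\<close> with the number of terms shifted by one, which leaves the limit
  unchanged.\<close>

lemma z_elt_Suc: "z_elt t a n r = emb (a r) + e ^ (n (Suc r) - n r) * z_elt t a n (Suc r)"
proof -
  \<comment> \<open>This growth makes the partial sums Cauchy and keeps the subtractions of
    exponents below from truncating.\<close>
  have mono: "n r + i \<le> n (r + i)" for r i
  proof (induction i)
    case (Suc i)
    then show ?case using n_Suc[of "r + i"] by simp
  qed simp
  define S where "S = (\<lambda>r k. \<Sum>i<k. a (r + i) * t ^ (n (r + i) - n r))"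
  have z_S: "z_elt t a n r = Fract (of_seq (S r)) 1" for r by (simp add: z_elt_def S_def)
  have cauchy: "adic_cauchy (S r)" for r
  proof (rule adic_cauchyI_Suc[OF t])
    fix i
    have "t ^ i dvd t ^ (n (r + i) - n r)" using mono[of r i] by (intro le_imp_power_dvd) simp
    then show "t ^ i dvd S r (Suc i) - S r i" by (simp add: S_def)
  qed
  have "S r (Suc k) = a r + t ^ (n (Suc r) - n r) * S (Suc r) k" for k
  proof -
    have *: "n (Suc (r + i)) - n r = (n (Suc r) - n r) + (n (Suc (r + i)) - n (Suc r))" for i
      using mono[of r 1] mono[of "Suc r" i] by simp
    show ?thesis
      unfolding S_def sum.lessThan_Suc_shift
      by (simp add: sum_distrib_left * power_add mult_ac)
  qed
  then have "of_seq (S r) = of_seq (\<lambda>_. a r) +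
      of_seq (\<lambda>_. t ^ (n (Suc r) - n r)) * of_seq (S (Suc r))"
    using of_seq_shift[OF cauchy, of r]
    by (simp add: of_seq_add of_seq_mult cauchy adic_cauchy_const adic_cauchy_mult)
  then show ?thesis
    unfolding z_S emb_power[symmetric] by (simp add: emb_def)
qed

lemma is_subring_C: "is_subring C"
  unfolding ring_C_def by (rule is_subring_subring_span)

lemma ring_A_subset_C: "ring_A \<subseteq> C"
  and tau_in_C: "\<tau> \<in> C"
  and w_square_in_C: "(w i)\<^sup>2 \<in> C"
proof -
  have *: "ring_A \<union> {\<tau>} \<union> {(w i)\<^sup>2 |i. True} \<subseteq> C"
    unfolding ring_C_def by (rule subring_span_superset)
  then show "ring_A \<subseteq> C" "\<tau> \<in> C" by simp_all
  from * have "{(w i)\<^sup>2 |i. True} \<subseteq> C" by simp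
  then show "(w i)\<^sup>2 \<in> C" by (rule subsetD) (rule CollectI, iprover)
qed

lemma e_in_C: "e \<in> C"
  using emb_in_ring_A ring_A_subset_C by blast

lemmas C_closed = is_subringD[OF is_subring_C] e_in_C tau_in_C
lemmas A_in_C = subsetD[OF ring_A_subset_C]

lemma tau_eq: "\<tau> = e * w 0"
  by (simp add: tau_def)

lemma tau_square: "\<tau> * \<tau> = e * (e * (w 0)\<^sup>2)"
  by (simp add: tau_eq power2_eq_square mult_ac)

lemma w_eq: "w i = e ^ (n (Suc i) - n i) * (emb (a (Suc i)) + w (Suc i))"
  using z_elt_Suc[of i] by simp

text \<open>Each application of \<open>w_eq\<close> changes the product by an element of A only, and
  for \<open>i = 0\<close> the product is \<open>\<tau>\<close> itself since \<open>n 0 = 0\<close>.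
  Thus this multiple of \<open>w i\<close> lies in \<open>C\<close>, although only the squares of
  the \<open>w i\<close> are among the generators.\<close>

lemma e_power_w: "e ^ (n i + 1) * w i - \<tau> \<in> ring_A"
proof (induction i)
  case 0
  show ?case by (simp add: n_0 tau_eq is_subring_zero[OF is_subring_ring_A])
next
  case (Suc i)
  have "(n i + 1) + (n (Suc i) - n i) = n (Suc i) + 1" using n_Suc[of i] by simp
  then have "e ^ (n i + 1) * e ^ (n (Suc i) - n i) = e ^ (n (Suc i) + 1)"
    by (simp only: power_add[symmetric])
  then have "e ^ (n i + 1) * w i = e ^ (n (Suc i) + 1) * (emb (a (Suc i)) + w (Suc i))"
    by (simp only: w_eq[of i] mult.assoc[symmetric])
  then have "e ^ (n (Suc i) + 1) * w (Suc i) - \<tau> =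
      (e ^ (n i + 1) * w i - \<tau>) - e ^ (n (Suc i) + 1) * emb (a (Suc i))"
    by (simp add: algebra_simps)
  then show ?case
    using Suc is_subringD[OF is_subring_ring_A] emb_in_ring_A by metis
qed

text \<open>The growth condition on \<open>n\<close> enters here: it makes the power of \<open>t\<close> in the cross term of
  \<open>w\<^sub>i\<^sup>2\<close> large enough to turn that term into an \<open>A\<close>-combination of \<open>1\<close> and \<open>\<tau>\<close>.\<close>

lemma w_square_in_e_C: "\<exists>c\<in>C. (w i)\<^sup>2 = e * c"
proof -
  define m where "m = n (Suc i) - n i"
  define q where "q = 2 * m - (n (Suc i) + 2)"
  have q: "2 * m = (n (Suc i) + 1) + Suc q" using n_Suc[of i] by (simp add: m_def q_def)
  define b where "b = emb (a (Suc i))"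
  define v where "v = w (Suc i)"
  define \<beta> where "\<beta> = e ^ (n (Suc i) + 1) * v"
  have "\<beta> - \<tau> \<in> C" using e_power_w[of "Suc i"] ring_A_subset_C by (auto simp: \<beta>_def v_def)
  then have "(\<beta> - \<tau>) + \<tau> \<in> C" by (rule C_closed) (rule C_closed)
  then have \<beta>: "\<beta> \<in> C" by simp
  have b: "b \<in> C" using ring_A_subset_C by (auto simp: b_def ring_A_def)
  have v2: "v * v \<in> C" using w_square_in_C[of "Suc i"] by (simp add: v_def power2_eq_square)
  have "e ^ m * e ^ m = e ^ (n (Suc i) + 1) * (e * e ^ q)"
    by (simp only: power_add[symmetric] power_Suc[symmetric] mult_2[symmetric] q)
  moreover have "w i = e ^ m * (b + v)"
    unfolding m_def b_def v_def by (rule w_eq)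
  ultimately have "(w i)\<^sup>2 = e ^ (n (Suc i) + 1) * (e * e ^ q) * ((b + v) * (b + v))"
    by (simp only: power2_eq_square ac_simps)
  also have "\<dots> = e * (e ^ (n (Suc i) + 1) * e ^ q * (b * b + v * v) + e ^ q * (b + b) * \<beta>)"
    unfolding \<beta>_def by (simp only: distrib_left distrib_right ac_simps)
  finally show ?thesis
    by (rule bexI) (intro \<beta> b v2 C_closed)
qed

text \<open>The set \<open>N\<close> of such sums contains the generators because the squares of the
  \<open>w i\<close> lie in \<open>e * C\<close>, and it is closed under products because \<tau>^2
  lies in \<open>e * C\<close> as well.\<close>

lemma C_decomp:
  assumes "f \<in> C"
  shows "\<exists>x\<in>ring_A. \<exists>y\<in>ring_A. \<exists>c\<in>C. f = x + y * \<tau> + e * c"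
proof -
  define N where "N = {x + y * \<tau> + e * c |x y c. x \<in> ring_A \<and> y \<in> ring_A \<and> c \<in> C}"
  have N_I: "x + y * \<tau> + e * c \<in> N" if "x \<in> ring_A" "y \<in> ring_A" "c \<in> C" for x y c
    unfolding N_def using that by blast
  note A_closed = is_subringD[OF is_subring_ring_A]
  have "C \<subseteq> N"
    unfolding ring_C_def
  proof (rule subring_span_least)
    have "x \<in> N" if "x \<in> ring_A" for x
      using N_I[OF that A_closed(2) C_closed(2)] by simp
    moreover have "\<tau> \<in> N" using N_I[OF A_closed(2,1) C_closed(2)] by simp
    moreover have "(w i)\<^sup>2 \<in> N" for i
      using w_square_in_e_C[of i] N_I[OF A_closed(2,2)] by auto
    ultimately show "ring_A \<union> {\<tau>} \<union> {(w i)\<^sup>2 |i. True} \<subseteq> N" by blast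
    show "is_subring N"
      unfolding is_subring_def
    proof (intro conjI ballI)
      show "1 \<in> N" using N_I[OF A_closed(1,2) C_closed(2)] by simp
      fix f g assume "f \<in> N" "g \<in> N"
      then obtain x y c x' y' c' where fg: "f = x + y * \<tau> + e * c" "g = x' + y' * \<tau> + e * c'"
        and A: "x \<in> ring_A" "y \<in> ring_A" "x' \<in> ring_A" "y' \<in> ring_A" and c: "c \<in> C" "c' \<in> C"
        unfolding N_def by blast
      have "f - g = (x - x') + (y - y') * \<tau> + e * (c - c')"
        by (simp add: fg algebra_simps)
      moreover have "\<dots> \<in> N" by (intro A c N_I A_closed C_closed)
      ultimately show "f - g \<in> N" by simp
      have "f * g = x * x' + (x * y' + y * x') * \<tau> + y * y' * (\<tau> * \<tau>)
          + e * ((x + y * \<tau>) * c' + c * (x' + y' * \<tau> + e * c'))"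
        by (simp add: fg algebra_simps)
      also have "\<dots> = x * x' + (x * y' + y * x') * \<tau> + e * (y * y' * (e * (w 0)\<^sup>2)
          + ((x + y * \<tau>) * c' + c * (x' + y' * \<tau> + e * c')))"
        unfolding tau_square by (simp add: algebra_simps)
      also have "\<dots> \<in> N" by (intro A c A[THEN A_in_C] N_I A_closed w_square_in_C C_closed)
      finally show "f * g \<in> N" .
    qed
  qed
  then show ?thesis using assms unfolding N_def by blast
qed

section \<open>The ideal M and its complement in C\<close>

lemma C_subset_ring_Ahat: "C \<subseteq> ring_Ahat"
  unfolding ring_C_def
proof (rule subring_span_least[OF _ is_subring_ring_Ahat])
  note closed = is_subringD[OF is_subring_ring_Ahat]
  have w: "w i \<in> ring_Ahat" for i by (intro closed z_elt_in_ring_Ahat emb_in_ring_Ahat)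
  have "\<tau> \<in> ring_Ahat" unfolding tau_eq by (intro closed(4) w emb_in_ring_Ahat)
  moreover have "(w i)\<^sup>2 \<in> ring_Ahat" for i by (intro closed(7) w)
  ultimately show "ring_A \<union> {\<tau>} \<union> {(w i)\<^sup>2 |i. True} \<subseteq> ring_Ahat"
    using ring_A_subset_ring_Ahat by auto
qed

text \<open>Both generators are multiples of \<open>e\<close> in \<open>ring_Ahat\<close>, as
  \<open>\<tau> = e * w 0\<close>. This is what makes M a proper ideal.\<close>

lemma M_subset: "M \<subseteq> (*) e ` ring_Ahat"
  unfolding ideal_M_def
proof (rule ideal_span_least)
  note closed = is_subringD[OF is_subring_ring_Ahat]
  show "{e, \<tau>} \<subseteq> (*) e ` ring_Ahat"
    using closed(1) closed(3)[OF z_elt_in_ring_Ahat emb_in_ring_Ahat] by (force simp: tau_eq)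
  show "0 \<in> (*) e ` ring_Ahat" using closed(2) by force
  show "x + y \<in> (*) e ` ring_Ahat" if "x \<in> (*) e ` ring_Ahat" "y \<in> (*) e ` ring_Ahat" for x y
    using that by (auto simp flip: distrib_left intro!: imageI closed(6))
  show "r * x \<in> (*) e ` ring_Ahat" if "r \<in> C" "x \<in> (*) e ` ring_Ahat" for r x
    using that C_subset_ring_Ahat by (auto simp: mult.left_commute intro!: imageI closed(4))
qed

lemma M_I: "c \<in> C \<Longrightarrow> d \<in> C \<Longrightarrow> c * e + d * \<tau> \<in> M"
  unfolding ideal_M_def using ideal_span_superset[of "{e, \<tau>}" C]
  by (intro ideal_span_add ideal_span_mult) auto

text \<open>M contains all multiples of \<open>t\<close> from A, so an element of A outside M is a
  unit of the discrete valuation ring.\<close>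

lemma inversemb_in_ring_A:
  assumes "x \<in> ring_A" "x \<notin> M"
  shows "x \<noteq> 0" "1 / x \<in> ring_A"
proof -
  obtain r where r: "x = emb r" using assms(1) by (auto simp: ring_A_def)
  have "\<not> t dvd r"
  proof
    assume "t dvd r"
    then obtain s where "r = t * s" by (rule dvdE)
    then have "x = emb s * e + 0 * \<tau>" by (simp add: r emb_mult)
    moreover have "emb s \<in> C" using ring_A_subset_C by (auto simp: ring_A_def)
    ultimately show False using assms(2) M_I C_closed(2) by metis
  qed
  then have "r dvd 1" by (simp add: unit_iff)
  then obtain s where "1 = r * s" by (rule dvdE)
  then have *: "x * emb s = 1" by (metis r emb_mult emb_1)
  then show "x \<noteq> 0" by auto
  with * have "1 / x = emb s" by (simp add: field_simps)
  then show "1 / x \<in> ring_A" by (simp add: ring_A_def)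
qed

lemma M_diff_iff:
  assumes "m \<in> M"
  shows "f + m \<in> M \<longleftrightarrow> f \<in> M"
proof -
  have *: "f + m \<in> M" if "f \<in> M" "m \<in> M" for f m
    using that unfolding ideal_M_def by (rule ideal_span_add)
  have "- 1 * m \<in> M"
    using assms C_closed(1,5) unfolding ideal_M_def by (intro ideal_span_mult) auto
  from *[OF _ this, of "f + m"] *[OF _ assms, of f] show ?thesis by auto
qed

text \<open>In the decomposition of \<open>s\<close>, everything except \<open>x\<close> lies in M,
  so \<open>x\<close> lies outside M and is a unit of A.\<close>

lemma C_minus_M_decomp:
  assumes "s \<in> C - M"
  obtains x y c where "s = x + y * \<tau> + e * c" "x \<in> ring_A" "y \<in> ring_A" "c \<in> C"
    "x \<noteq> 0" "1 / x \<in> ring_A"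
proof -
  obtain x y c where *: "s = x + y * \<tau> + e * c" "x \<in> ring_A" "y \<in> ring_A" "c \<in> C"
    using C_decomp assms by blast
  have "c * e + y * \<tau> \<in> M" using * A_in_C by (intro M_I) auto
  then have "x \<notin> M" using M_diff_iff[of "c * e + y * \<tau>" x] * assms by (auto simp: algebra_simps)
  with * inversemb_in_ring_A that show thesis by blast
qed

text \<open>Modulo M the factor \<open>s\<close> is a unit \<open>x\<close> of A, so multiplying a
  product in M by its inverse would put \<open>s'\<close> in M. Hence the denominators of
  \<open>CM\<close> are closed under multiplication.\<close>

lemma C_minus_M_mult:
  assumes "s \<in> C - M" "s' \<in> C - M"
  shows "s * s' \<in> C - M"
proof -
  obtain x y c where s: "s = x + y * \<tau> + e * c" "x \<in> ring_A" "y \<in> ring_A" "c \<in> C"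
    "x \<noteq> 0" "1 / x \<in> ring_A" by (rule C_minus_M_decomp[OF assms(1)])
  have "s * s' \<notin> M"
  proof
    assume "s * s' \<in> M"
    define i where "i = 1 / x"
    have i: "i \<in> C" "i * x = 1" using A_in_C[OF s(6)] s(5) by (simp_all add: i_def)
    have "i * (s * s') \<in> M"
      using i(1) \<open>s * s' \<in> M\<close> unfolding ideal_M_def by (rule ideal_span_mult)
    moreover have "i * (s * s') = (i * x) * s' + ((i * c * s') * e + (i * y * s') * \<tau>)"
      unfolding s(1) by (simp only: distrib_left distrib_right ac_simps)
    then have "i * (s * s') = s' + ((i * c * s') * e + (i * y * s') * \<tau>)" using i by simp
    moreover have "(i * c * s') * e + (i * y * s') * \<tau> \<in> M"
      using assms by (intro M_I C_closed(4) i A_in_C[OF s(3)] s(4)) auto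
    ultimately have "s' \<in> M" using M_diff_iff by metis
    then show False using assms by simp
  qed
  then show ?thesis using assms C_closed(4) by auto
qed

lemma one_in_C_minus_M: "1 \<in> C - M"
proof -
  have "1 \<notin> M"
  proof
    assume "1 \<in> M"
    then have "1 \<in> (*) e ` ring_Ahat" by (rule subsetD[OF M_subset])
    then obtain c where "1 = e * c" "c \<in> ring_Ahat" by (rule imageE)
    then show False using one_not_in_e_Ahat by metis
  qed
  with C_closed(1) show ?thesis by (rule DiffI)
qed

lemma C_minus_M_nonzero: "s \<in> C - M \<Longrightarrow> s \<noteq> 0"
  using ideal_span_zero[of C "{e, \<tau>}"] unfolding ideal_M_def by (metis DiffD2)

section \<open>The localization of C at M\<close>

lemma CM_I: "f \<in> C \<Longrightarrow> s \<in> C - M \<Longrightarrow> f / s \<in> CM"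
  unfolding ring_CM_def localize_def by blast

lemma C_subset_CM: "C \<subseteq> CM"
  using CM_I[OF _ one_in_C_minus_M] by (metis div_by_1 subsetI)

lemma CM_E:
  assumes "f \<in> CM"
  obtains g s where "f = g / s" "g \<in> C" "s \<in> C - M" "s \<noteq> 0"
proof -
  from assms obtain g s where "f = g / s" "g \<in> C" "s \<in> C - M"
    unfolding ring_CM_def localize_def by (elim CollectE exE conjE)
  then show thesis using that C_minus_M_nonzero by metis
qed

lemma is_subring_CM: "is_subring CM"
  unfolding is_subring_def
proof (intro conjI ballI)
  show "1 \<in> CM" using C_subset_CM C_closed(1) by blast
  fix f f' assume "f \<in> CM" "f' \<in> CM"
  obtain g s where 1: "f = g / s" "g \<in> C" "s \<in> C - M" "s \<noteq> 0"
    using \<open>f \<in> CM\<close> by (rule CM_E)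
  obtain g' s' where 2: "f' = g' / s'" "g' \<in> C" "s' \<in> C - M" "s' \<noteq> 0"
    using \<open>f' \<in> CM\<close> by (rule CM_E)
  have "f - f' = (g * s' - s * g') / (s * s')" "f * f' = (g * g') / (s * s')"
    unfolding 1(1) 2(1)
    by (simp_all only: diff_frac_eq[OF 1(4) 2(4)] times_divide_times_eq ac_simps)
  moreover have "g * s' - s * g' \<in> C" "g * g' \<in> C"
    using 1(2,3) 2(2,3) by (auto intro!: C_closed)
  moreover have "s * s' \<in> C - M" by (rule C_minus_M_mult[OF 1(3) 2(3)])
  ultimately show "f - f' \<in> CM" "f * f' \<in> CM"
    using CM_I by simp_all
qed

lemmas CM_closed = is_subringD[OF is_subring_CM]
lemmas C_in_CM = subsetD[OF C_subset_CM]

lemma ring_A_subset_CM: "ring_A \<subseteq> CM"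
  using ring_A_subset_C C_subset_CM by blast

text \<open>Multiplying the denominator \<open>x + y\<tau> + tc\<close> by \<open>x - y\<tau>\<close> gives the unit \<open>x\<^sup>2\<close> of \<open>A\<close>
  modulo \<open>t\<close>, because \<open>t\<close> divides \<open>\<tau>\<^sup>2\<close>.\<close>

lemma CM_decomp_1:
  assumes "f \<in> CM"
  shows "\<exists>X\<in>ring_A. \<exists>Y\<in>ring_A. \<exists>g\<in>CM. f = X + Y * \<tau> + e * g"
proof -
  obtain h s where f: "f = h / s" "h \<in> C" "s \<in> C - M" "s \<noteq> 0" using assms by (rule CM_E)
  obtain x y c where s: "s = x + y * \<tau> + e * c" "x \<in> ring_A" "y \<in> ring_A" "c \<in> C"
    "x \<noteq> 0" "1 / x \<in> ring_A" by (rule C_minus_M_decomp[OF f(3)])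
  define i where "i = 1 / x"
  have i: "i \<in> C" "i * x = 1" using s A_in_C by (auto simp: i_def)
  \<comment> \<open>\<open>d\<close> is the cofactor of \<open>e\<close> in the product of
    \<open>s\<close> and \<open>x - y * \<tau>\<close>, that is, the product is
    \<open>x * x + e * d\<close>.\<close>
  define d where "d = c * (x - y * \<tau>) - y * y * (e * (w 0)\<^sup>2)"
  have d: "d \<in> C" unfolding d_def by (intro s s(2,3)[THEN A_in_C] w_square_in_C C_closed)
  have "s * (x - y * \<tau>) = x * x - y * y * (\<tau> * \<tau>) + e * c * (x - y * \<tau>)"
    unfolding s(1) by (simp add: algebra_simps)
  also have "\<dots> = x * x + e * d" unfolding tau_square d_def by (simp add: algebra_simps)
  finally have "i * i * h * (s * (x - y * \<tau>)) = (i * x) * (i * x) * h + e * (i * i * h * d)"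
    by (simp add: algebra_simps)
  then have "h = s * (i * i * h * (x - y * \<tau>)) - e * (i * i * h * d)"
    using i by (simp add: algebra_simps)
  then have f_eq: "f = i * i * h * (x - y * \<tau>) - e * (i * i * h * d / s)"
    using f by (simp add: field_simps)
  have "i * i * h * (x - y * \<tau>) \<in> C" by (intro i f s(2,3)[THEN A_in_C] C_closed)
  then obtain X Y b where XY: "X \<in> ring_A" "Y \<in> ring_A" "b \<in> C"
    and "i * i * h * (x - y * \<tau>) = X + Y * \<tau> + e * b" using C_decomp by blast
  then have "f = X + Y * \<tau> + e * (b - i * i * h * d / s)"
    using f_eq by (simp add: algebra_simps)
  moreover have "i * i * h * d / s \<in> CM" by (intro i f d CM_I C_closed)
  then have "b - i * i * h * d / s \<in> CM" by (intro C_in_CM[OF XY(3)] CM_closed)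
  ultimately show ?thesis using XY by blast
qed

text \<open>Decomposing the remainder again raises the power of \<open>e\<close> by one, and the new
  coefficients, scaled by \<open>e ^ k\<close>, are absorbed into the old ones.\<close>

lemma CM_decomp:
  assumes "f \<in> CM"
  shows "\<exists>X\<in>ring_A. \<exists>Y\<in>ring_A. \<exists>g\<in>CM. f = X + Y * \<tau> + e ^ k * g"
proof (induction k)
  case 0
  show ?case
    using assms is_subring_zero[OF is_subring_ring_A] by (intro bexI[of _ 0] bexI[of _ f]) auto
next
  case (Suc k)
  then obtain X Y g where 1: "X \<in> ring_A" "Y \<in> ring_A" "f = X + Y * \<tau> + e ^ k * g" "g \<in> CM"
    by blast
  from CM_decomp_1[OF 1(4)] obtain X' Y' g' where 2: "X' \<in> ring_A" "Y' \<in> ring_A" "g' \<in> CM"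
    "g = X' + Y' * \<tau> + e * g'" by blast
  have "f = (X + e ^ k * X') + (Y + e ^ k * Y') * \<tau> + e ^ Suc k * g'"
    by (simp add: 1(3) 2(4) algebra_simps)
  moreover have "X + e ^ k * X' \<in> ring_A" "Y + e ^ k * Y' \<in> ring_A"
    using 1 2 emb_in_ring_A by (auto intro!: is_subringD[OF is_subring_ring_A])
  ultimately show ?case using 2(3) by blast
qed

section \<open>Classes in the local cohomology module\<close>

lemma H1_I: "f \<in> CM \<Longrightarrow> (f / e ^ k) +o CM \<in> H1 t a n"
  unfolding H1_def quot_def localize_def by blast

lemma H1_E:
  assumes "\<omega> \<in> H1 t a n"
  obtains f k where "\<omega> = (f / e ^ k) +o CM" "f \<in> CM"
  using assms unfolding H1_def quot_def localize_def by blast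

lemma H1_representation:
  assumes "\<omega> \<in> H1 t a n"
  obtains X Y k where "X \<in> ring_A" "Y \<in> ring_A" "k > 0" "\<omega> = gfrac_CM t a n (X + Y * \<tau>) k"
proof -
  obtain f k where f: "\<omega> = (f / e ^ k) +o CM" "f \<in> CM" using assms by (rule H1_E)
  \<comment> \<open>Numerator and denominator are enlarged by \<open>e\<close>, so that the exponent
    \<open>Suc k\<close> is positive even for \<open>k = 0\<close>. The remainder
    \<open>e ^ Suc k * g\<close> then contributes only \<open>g\<close>, whose class is
    zero.\<close>
  have "f * e \<in> CM" by (intro f(2) C_in_CM[OF e_in_C] CM_closed)
  from CM_decomp[OF this, of "Suc k"] obtain X Y g
    where *: "X \<in> ring_A" "Y \<in> ring_A" "g \<in> CM" "f * e = X + Y * \<tau> + e ^ Suc k * g" by blast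
  have "f / e ^ k - (X + Y * \<tau>) / e ^ Suc k = (f * e - (X + Y * \<tau>)) / e ^ Suc k"
    using e_nonzero by (simp add: field_simps)
  also have "\<dots> = g" using *(4) e_nonzero by simp
  finally have "\<omega> = gfrac_CM t a n (X + Y * \<tau>) (Suc k)"
    using *(3) by (simp add: f gfrac_CM_def coset_eq_iff[OF is_subring_CM])
  with * that show thesis by blast
qed

lemma quot_scale_H1:
  assumes "f \<in> CM" "\<omega> \<in> H1 t a n"
  shows "quot_scale CM f \<omega> \<in> H1 t a n"
proof -
  obtain h k where h: "\<omega> = (h / e ^ k) +o CM" "h \<in> CM" using assms(2) by (rule H1_E)
  then have "quot_scale CM f \<omega> = ((f * h) / e ^ k) +o CM"
    using assms(1) by (simp add: quot_scale_coset[OF is_subring_CM])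
  then show ?thesis using H1_I CM_closed(4)[OF assms(1) h(2)] by simp
qed

section \<open>Linear maps from the local cohomology to \<open>K/A\<close>\<close>

text \<open>This is the passage to the limit, used for \<open>u = 1\<close> to find
  \<open>\<sigma>\<close> and for \<open>u = \<tau>\<close> to find \<open>\<rho>\<close>. The
  element \<open>x\<close> is a term \<open>emb (s k)\<close> of the approximating sequence.\<close>

lemma linear_functional_on_line:
  assumes closed: "\<And>\<omega>. \<omega> \<in> H1 t a n \<Longrightarrow> \<psi> \<omega> \<in> K_mod_A"
    and scale: "\<And>x \<omega>. x \<in> ring_A \<Longrightarrow> \<omega> \<in> H1 t a n \<Longrightarrow>
      \<psi> (quot_scale CM x \<omega>) = quot_scale ring_A x (\<psi> \<omega>)"
    and u: "u \<in> CM"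
  obtains \<sigma> where "\<sigma> \<in> ring_Ahat"
    "\<And>k. \<exists>x\<in>ring_A. \<psi> ((u / e ^ k) +o CM) = (x / e ^ k) +o ring_A \<and> (x - \<sigma>) / e ^ k \<in> ring_Ahat"
proof -
  note A = is_subring_ring_A and scale_A = quot_scale_coset[OF is_subring_ring_A]
    and scale_CM = quot_scale_coset[OF is_subring_CM]
  have eA: "e ^ k \<in> ring_A" for k by (rule is_subring_power[OF A emb_in_ring_A])
  have e0: "e ^ k \<noteq> 0" for k using e_nonzero by simp
  have "\<exists>s. \<psi> ((u / e ^ k) +o CM) = (emb s / e ^ k) +o ring_A" for k
  proof -
    have in_H1: "(u / e ^ k) +o CM \<in> H1 t a n" by (rule H1_I[OF u])
    then obtain y where y: "\<psi> ((u / e ^ k) +o CM) = y +o ring_A"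
      using closed by (auto simp: quot_def)
    \<comment> \<open>The zero class is written as the class scaled by 0, so compatibility with
      scalars alone shows that \<open>e ^ k\<close> annihilates the value of
      \<open>\<psi>\<close>.\<close>
    have "e ^ k * (u / e ^ k) - 0 * (u / e ^ k) \<in> CM" using u e0[of k] by simp
    then have "(e ^ k * (u / e ^ k)) +o CM = (0 * (u / e ^ k)) +o CM"
      by (simp only: coset_eq_iff[OF is_subring_CM])
    then have "quot_scale CM (e ^ k) ((u / e ^ k) +o CM) = quot_scale CM 0 ((u / e ^ k) +o CM)"
      using eA[of k] ring_A_subset_CM by (simp add: scale_CM subset_iff CM_closed(2))
    then have "quot_scale ring_A (e ^ k) (y +o ring_A) = quot_scale ring_A 0 (y +o ring_A)"
      using scale[OF eA in_H1, of k] scale[OF is_subring_zero[OF A] in_H1] y by (simp only:)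
    then have "e ^ k * y - 0 * y \<in> ring_A"
      by (simp only: scale_A eA is_subring_zero[OF A] coset_eq_iff[OF A])
    then have "e ^ k * y \<in> ring_A" by simp
    then obtain s where "e ^ k * y = emb s" by (auto simp: ring_A_def)
    then have "y = emb s / e ^ k" using e0[of k] by (simp add: field_simps)
    with y show ?thesis by blast
  qed
  then obtain s where s: "\<And>k. \<psi> ((u / e ^ k) +o CM) = (emb (s k) / e ^ k) +o ring_A" by metis
  have s_step: "t ^ k dvd s (Suc k) - s k" for k
  proof -
    \<comment> \<open>Multiplication by \<open>e\<close> links consecutive levels; applying
      \<open>\<psi>\<close> gives the congruence of \<open>s (Suc k)\<close> and \<open>s k\<close>
      modulo \<open>t ^ k\<close>.\<close>
    have "quot_scale CM e ((u / e ^ Suc k) +o CM) = (u / e ^ k) +o CM"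
      using C_subset_CM e_in_C e_nonzero by (simp add: scale_CM subset_iff)
    then have "quot_scale ring_A e (\<psi> ((u / e ^ Suc k) +o CM)) = \<psi> ((u / e ^ k) +o CM)"
      using scale[OF emb_in_ring_A H1_I[OF u]] by metis
    then have "(e * (emb (s (Suc k)) / e ^ Suc k)) +o ring_A = (emb (s k) / e ^ k) +o ring_A"
      by (simp only: s scale_A emb_in_ring_A)
    then have "e * (emb (s (Suc k)) / e ^ Suc k) - emb (s k) / e ^ k \<in> ring_A"
      by (simp only: coset_eq_iff[OF A])
    then obtain r where "e * (emb (s (Suc k)) / e ^ Suc k) - emb (s k) / e ^ k = emb r"
      by (auto simp: ring_A_def)
    then have "emb (s (Suc k)) - emb (s k) = e ^ k * emb r"
      using e_nonzero by (simp add: field_simps)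
    then have "emb (s (Suc k) - s k - t ^ k * r) = 0"
      by (simp add: emb_diff emb_mult emb_power)
    then have "s (Suc k) - s k = t ^ k * r" by (simp add: emb_eq_0_iff)
    then show ?thesis by simp
  qed
  define \<sigma> where "\<sigma> = Fract (of_seq s) 1"
  have "(emb (s k) - \<sigma>) / e ^ k \<in> ring_Ahat" for k
  proof -
    obtain c where "of_seq s = of_seq (\<lambda>_. s k) + of_seq (\<lambda>_. t ^ k) * c"
      using limit_approx[OF t t_nonzero s_step] by blast
    then have "\<sigma> = emb (s k) + e ^ k * Fract c 1"
      by (simp add: \<sigma>_def flip: emb_power) (simp add: emb_def)
    then have "(emb (s k) - \<sigma>) / e ^ k = - Fract c 1" using e_nonzero by simp
    moreover have "Fract c 1 \<in> ring_Ahat" by (simp add: ring_Ahat_def)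
    ultimately show ?thesis using is_subring_uminus[OF is_subring_ring_Ahat] by metis
  qed
  moreover have "\<sigma> \<in> ring_Ahat" by (simp add: \<sigma>_def ring_Ahat_def)
  ultimately show thesis using that s by (metis rangeI ring_A_def)
qed

lemma linear_functional_eq_res:
  assumes closed: "\<And>\<omega>. \<omega> \<in> H1 t a n \<Longrightarrow> \<psi> \<omega> \<in> K_mod_A"
    and add: "\<And>\<omega> \<omega>'. \<omega> \<in> H1 t a n \<Longrightarrow> \<omega>' \<in> H1 t a n \<Longrightarrow> \<psi> (\<omega> + \<omega>') = \<psi> \<omega> + \<psi> \<omega>'"
    and scale: "\<And>x \<omega>. x \<in> ring_A \<Longrightarrow> \<omega> \<in> H1 t a n \<Longrightarrow>
      \<psi> (quot_scale CM x \<omega>) = quot_scale ring_A x (\<psi> \<omega>)"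
  shows "\<exists>\<sigma>\<in>ring_Ahat. \<exists>\<rho>\<in>ring_Ahat. \<forall>\<omega>\<in>H1 t a n. \<psi> \<omega> = res t a n \<sigma> \<rho> \<omega>"
proof -
  obtain \<sigma> where \<sigma>: "\<sigma> \<in> ring_Ahat" "\<And>k. \<exists>x\<in>ring_A.
      \<psi> ((1 / e ^ k) +o CM) = (x / e ^ k) +o ring_A \<and> (x - \<sigma>) / e ^ k \<in> ring_Ahat"
    using linear_functional_on_line[OF closed scale CM_closed(1)] by blast
  obtain \<rho> where \<rho>: "\<rho> \<in> ring_Ahat" "\<And>k. \<exists>x\<in>ring_A.
      \<psi> ((\<tau> / e ^ k) +o CM) = (x / e ^ k) +o ring_A \<and> (x - \<rho>) / e ^ k \<in> ring_Ahat"
    using linear_functional_on_line[OF closed scale C_in_CM[OF tau_in_C]] by blast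
  note Ahat_closed = is_subringD[OF is_subring_ring_Ahat] subsetD[OF ring_A_subset_ring_Ahat]
  \<comment> \<open>The formula is proved for every representation of a class, so it settles both
    existence and uniqueness in the description defining \<open>res\<close>.\<close>
  have value_eq: "\<psi> (gfrac_CM t a n (X + Y * \<tau>) k) = gfrac_A t (X * \<sigma> + Y * \<rho>) k"
    if XY: "X \<in> ring_A" "Y \<in> ring_A" for X Y k
  proof -
    obtain x where x: "x \<in> ring_A" "\<psi> ((1 / e ^ k) +o CM) = (x / e ^ k) +o ring_A"
      "(x - \<sigma>) / e ^ k \<in> ring_Ahat" using \<sigma>(2) by blast
    obtain y where y: "y \<in> ring_A" "\<psi> ((\<tau> / e ^ k) +o CM) = (y / e ^ k) +o ring_A"
      "(y - \<rho>) / e ^ k \<in> ring_Ahat" using \<rho>(2) by blast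
    have in_CM: "X \<in> CM" "Y \<in> CM" using XY ring_A_subset_CM by auto
    have in_H1: "(1 / e ^ k) +o CM \<in> H1 t a n" "(\<tau> / e ^ k) +o CM \<in> H1 t a n"
      using CM_closed(1) C_in_CM[OF tau_in_C] by (auto intro!: H1_I)
    have "gfrac_CM t a n (X + Y * \<tau>) k
        = quot_scale CM X ((1 / e ^ k) +o CM) + quot_scale CM Y ((\<tau> / e ^ k) +o CM)"
      using in_CM
      by (simp add: gfrac_CM_def quot_scale_coset[OF is_subring_CM] coset_plus[OF is_subring_CM]
          add_divide_distrib)
    then have "\<psi> (gfrac_CM t a n (X + Y * \<tau>) k)
        = quot_scale ring_A X ((x / e ^ k) +o ring_A) + quot_scale ring_A Y ((y / e ^ k) +o ring_A)"
      using in_H1 in_CM XY by (simp add: add scale quot_scale_H1 x(2) y(2))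
    also have "\<dots> = ((X * x + Y * y) / e ^ k) +o ring_A"
      using XY by (simp add: quot_scale_coset[OF is_subring_ring_A]
          coset_plus[OF is_subring_ring_A] add_divide_distrib)
    also have "\<dots> = gfrac_A t (X * \<sigma> + Y * \<rho>) k"
    \<comment> \<open>\<open>x\<close> and \<open>y\<close> approximate \<open>\<sigma>\<close> and
      \<open>\<rho>\<close> modulo \<open>e ^ k\<close> by elements of A, which supplies the
      required representative in K.\<close>
    proof (rule gfrac_A_eqI[symmetric])
      show "(X * x + Y * y) / e ^ k \<in> field_K"
        using XY x(1) y(1) by (intro field_K_divide is_subringD[OF is_subring_ring_A])
      have "(X * x + Y * y) / e ^ k - (X * \<sigma> + Y * \<rho>) / e ^ k
          = X * ((x - \<sigma>) / e ^ k) + Y * ((y - \<rho>) / e ^ k)"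
        using e_nonzero by (simp add: field_simps)
      also have "\<dots> \<in> ring_Ahat"
        using XY[THEN Ahat_closed(8)] x(3) y(3) by (intro Ahat_closed(4,6))
      finally show "(X * x + Y * y) / e ^ k - (X * \<sigma> + Y * \<rho>) / e ^ k \<in> ring_Ahat" .
    qed
    finally show ?thesis .
  qed
  have "\<psi> \<omega> = res t a n \<sigma> \<rho> \<omega>" if "\<omega> \<in> H1 t a n" for \<omega>
    unfolding res_def
  proof (rule the_equality[symmetric])
    obtain X Y k where "X \<in> ring_A" "Y \<in> ring_A" "k > 0" "\<omega> = gfrac_CM t a n (X + Y * \<tau>) k"
      using \<open>\<omega> \<in> H1 t a n\<close> by (rule H1_representation)
    then show "\<exists>X\<in>ring_A. \<exists>Y\<in>ring_A. \<exists>k>0.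
        \<omega> = gfrac_CM t a n (X + Y * \<tau>) k \<and> \<psi> \<omega> = gfrac_A t (X * \<sigma> + Y * \<rho>) k"
      using value_eq by blast
  qed (use value_eq in blast)
  then show ?thesis using \<sigma>(1) \<rho>(1) by blast
qed

text \<open>By linearity over \<open>CM\<close>, the value of \<open>\<Phi> \<omega>\<close> at
  \<open>f\<close> is the value at 1 of \<open>\<Phi>\<close> applied to \<open>f\<close> times
  \<open>\<omega>\<close>, so the functional at 1 determines \<open>\<Phi>\<close>.\<close>

lemma linear_map_eq_Phi_res:
  assumes "\<Phi> \<in> linear_maps_H1_Homc t a n"
  shows "\<exists>\<sigma>\<in>ring_Ahat. \<exists>\<rho>\<in>ring_Ahat. \<Phi> = Phi_res t a n \<sigma> \<rho>"
proof -
  have Phi: "\<Phi> \<in> H1 t a n \<rightarrow>\<^sub>E Homc t a n"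
    and add: "\<And>\<omega> \<omega>'. \<omega> \<in> H1 t a n \<Longrightarrow> \<omega>' \<in> H1 t a n \<Longrightarrow>
      \<Phi> (\<omega> + \<omega>') = (\<lambda>f\<in>CM. \<Phi> \<omega> f + \<Phi> \<omega>' f)"
    and scale: "\<And>g \<omega>. g \<in> CM \<Longrightarrow> \<omega> \<in> H1 t a n \<Longrightarrow>
      \<Phi> (quot_scale CM g \<omega>) = (\<lambda>f\<in>CM. \<Phi> \<omega> (g * f))"
    using assms by (auto simp: linear_maps_H1_Homc_def)
  have Hom: "\<Phi> \<omega> \<in> Hom_A_K_mod_A CM" if "\<omega> \<in> H1 t a n" for \<omega>
    using PiE_mem[OF Phi that] by (simp add: Homc_def)
  have at_1: "\<Phi> (quot_scale CM g \<omega>) 1 = \<Phi> \<omega> g" if "g \<in> CM" "\<omega> \<in> H1 t a n" for g \<omega>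
    using scale[OF that] CM_closed(1) by simp
  have "\<exists>\<sigma>\<in>ring_Ahat. \<exists>\<rho>\<in>ring_Ahat. \<forall>\<omega>\<in>H1 t a n. \<Phi> \<omega> 1 = res t a n \<sigma> \<rho> \<omega>"
  proof (rule linear_functional_eq_res)
    fix \<omega> assume \<omega>: "\<omega> \<in> H1 t a n"
    show "\<Phi> \<omega> 1 \<in> K_mod_A"
      using Hom[OF \<omega>] CM_closed(1) by (auto simp: Hom_A_K_mod_A_def)
    show "\<Phi> (\<omega> + \<omega>') 1 = \<Phi> \<omega> 1 + \<Phi> \<omega>' 1" if "\<omega>' \<in> H1 t a n" for \<omega>'
      using add[OF \<omega> that] CM_closed(1) by simp
    show "\<Phi> (quot_scale CM x \<omega>) 1 = quot_scale ring_A x (\<Phi> \<omega> 1)" if "x \<in> ring_A" for x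
    proof -
      \<comment> \<open>Two linearities combine: that of \<open>\<Phi>\<close> over
        \<open>CM\<close> moves \<open>x\<close> into the argument, and that of the homomorphism
        \<open>\<Phi> \<omega>\<close> over A takes it out.\<close>
      have "\<Phi> (quot_scale CM x \<omega>) 1 = \<Phi> \<omega> (x * 1)"
        using at_1[OF _ \<omega>] that ring_A_subset_CM by auto
      also have "\<dots> = quot_scale ring_A x (\<Phi> \<omega> 1)"
        using Hom[OF \<omega>] that CM_closed(1) unfolding Hom_A_K_mod_A_def by blast
      finally show ?thesis .
    qed
  qed
  then obtain \<sigma> \<rho> where \<sigma>\<rho>: "\<sigma> \<in> ring_Ahat" "\<rho> \<in> ring_Ahat"
    and *: "\<And>\<omega>. \<omega> \<in> H1 t a n \<Longrightarrow> \<Phi> \<omega> 1 = res t a n \<sigma> \<rho> \<omega>" by blast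
  \<comment> \<open>Equality of functions also concerns arguments outside \<open>H1\<close> and
    \<open>CM\<close>; there both sides are \<open>undefined\<close>.\<close>
  have "\<Phi> \<omega> f = Phi_res t a n \<sigma> \<rho> \<omega> f" for \<omega> f
  proof (cases "\<omega> \<in> H1 t a n")
    case \<omega>: True
    show ?thesis
    proof (cases "f \<in> CM")
      case True
      then show ?thesis
        using \<omega> at_1[OF True \<omega>] *[OF quot_scale_H1[OF True \<omega>]] by (simp add: Phi_res_def)
    next
      case False
      then show ?thesis
        using \<omega> Hom[OF \<omega>] by (auto simp: Phi_res_def Hom_A_K_mod_A_def)
    qed
  next
    case False
    then show ?thesis using PiE_arb[OF Phi False] by (simp add: Phi_res_def)
  qed
  then have "\<Phi> = Phi_res t a n \<sigma> \<rho>" by (intro ext)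
  with \<sigma>\<rho> show ?thesis by blast
qed

end

theorem proposition6:
  fixes t :: "'a::dvr" and a :: "nat \<Rightarrow> 'a" and n :: "nat \<Rightarrow> nat"
    and \<Phi> :: "'a completion fract set \<Rightarrow> 'a completion fract \<Rightarrow> 'a completion fract set"
  assumes "max_ideal = {x. t dvd x}"
    and "\<And>i. a i \<notin> max_ideal"
    and "n 0 = 0"
    and "\<And>r. r \<ge> 1 \<Longrightarrow> n r \<ge> 2 * n (r - 1) + 2"
    and "transcendental_over_A (z_elt t a n 0)"
    and "\<Phi> \<in> linear_maps_H1_Homc t a n"
  shows "\<exists>\<sigma>\<in>ring_Ahat. \<exists>\<rho>\<in>ring_Ahat. \<Phi> = Phi_res t a n \<sigma> \<rho>"
proof -
  interpret akizuki t a n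
    by unfold_locales (fact assms)+
  show ?thesis by (rule linear_map_eq_Phi_res) (fact assms)
qed

end
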